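(* Let $H$ be a complex Hilbert space and $T\in B(H)$ a Fredholm operator such that either $0\notin\sigma_w(T)$ or $0$ is an accumulation point of $\sigma_w(T)$. If $(T_n)$ is a sequence of essentially $G_1$ operators in $B(H)$ with $T_n\overset{\nu}{\to}T$, then $\sigma_w(T_n)\to\sigma_w(T)$ in the Hausdorff metric.
   Context: $\sigma_w(S)$ is the set of $\lambda$ with $S-\lambda$ not Fredholm of index zero. With $\pi:B(H)\to B(H)/K(H)$ the Calkin map and $\sigma_e(S)$ the spectrum of $\pi(S)$, $S$ is essentially $G_1$ if $\|(\pi(S)-z)^{-1}\|=1/d(z,\sigma_e(S))$ for all $z\notin\sigma_e(S)$. $T_n\overset{\nu}{\to}T$ means $(\|T_n\|)$ bounded, $\|(T_n-T)T\|\to0$, $\|(T_n-T)T_n\|\to0$. *)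

theory Defs
  imports "HOL-Analysis.Analysis"
begin

class complex_vector_space = real_vector +
  fixes scaleC :: "complex \<Rightarrow> 'a \<Rightarrow> 'a"
  assumes scaleC_add_right: "scaleC a (x + y) = scaleC a x + scaleC a y"
    and scaleC_add_left: "scaleC (a + b) x = scaleC a x + scaleC b x"
    and scaleC_scaleC: "scaleC a (scaleC b x) = scaleC (a * b) x"
    and scaleC_one: "scaleC 1 x = x"
    and scaleR_scaleC: "scaleR r x = scaleC (complex_of_real r) x"

class complex_inner_space = complex_vector_space + real_normed_vector +
  fixes cinner :: "'a \<Rightarrow> 'a \<Rightarrow> complex"
  assumes cinner_commute: "cinner x y = cnj (cinner y x)"
    and cinner_add_left: "cinner (x + y) z = cinner x z + cinner y z"
    and cinner_scaleC_left: "cinner (scaleC a x) y = cnj a * cinner x y"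
    and cinner_ge_zero: "0 \<le> Re (cinner x x)"
    and cinner_eq_zero_iff: "cinner x x = 0 \<longleftrightarrow> x = 0"
    and norm_eq_sqrt_cinner: "norm x = sqrt (Re (cinner x x))"


instantiation complex :: complex_inner_space
begin
definition scaleC_complex :: "complex \<Rightarrow> complex \<Rightarrow> complex" where "scaleC_complex a x = a * x"
definition cinner_complex :: "complex \<Rightarrow> complex \<Rightarrow> complex" where "cinner_complex x y = cnj x * y"
instance
proof
  fix x y z :: complex and a b :: complex and r :: real
  show "scaleC a (x + y) = scaleC a x + scaleC a y" by (simp add: scaleC_complex_def algebra_simps)
  show "scaleC (a + b) x = scaleC a x + scaleC b x" by (simp add: scaleC_complex_def algebra_simps)
  show "scaleC a (scaleC b x) = scaleC (a * b) x" by (simp add: scaleC_complex_def)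
  show "scaleC 1 x = x" by (simp add: scaleC_complex_def)
  show "r *\<^sub>R x = scaleC (complex_of_real r) x" by (simp add: scaleC_complex_def scaleR_conv_of_real)
  show "cinner x y = cnj (cinner y x)" by (simp add: cinner_complex_def)
  show "cinner (x + y) z = cinner x z + cinner y z" by (simp add: cinner_complex_def algebra_simps)
  show "cinner (scaleC a x) y = cnj a * cinner x y" by (simp add: cinner_complex_def scaleC_complex_def)
  show "0 \<le> Re (cinner x x)" by (simp add: cinner_complex_def)
  show "(cinner x x = 0) = (x = 0)" by (simp add: cinner_complex_def)
  show "norm x = sqrt (Re (cinner x x))" by (simp add: cinner_complex_def cmod_def power2_eq_square)
qed
end

text \<open>Complex Hilbert spaces are the complete complex inner product spaces,
  i.e. types of sort {complex_inner_space, complete_space}.\<close>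

definition bounded_clinear :: "('a::complex_inner_space \<Rightarrow> 'a) \<Rightarrow> bool" where
  "bounded_clinear T \<longleftrightarrow> bounded_linear T \<and> (\<forall>c x. T (scaleC c x) = scaleC c (T x))"

definition compact_op :: "('a::complex_inner_space \<Rightarrow> 'a) \<Rightarrow> bool" where
  "compact_op K \<longleftrightarrow> bounded_clinear K \<and> compact (closure (K ` ball 0 1))"

definition ker_op :: "('a::complex_inner_space \<Rightarrow> 'a) \<Rightarrow> 'a set" where
  "ker_op T = {x. T x = 0}"

definition orth_compl :: "'a::complex_inner_space set \<Rightarrow> 'a set" where
  "orth_compl S = {y. \<forall>x\<in>S. cinner x y = 0}"

text \<open>Finite-dimensionality (over the reals, equivalently over the complexes).\<close>
definition fin_dim :: "'a::real_vector set \<Rightarrow> bool" where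
  "fin_dim S \<longleftrightarrow> (\<exists>B. finite B \<and> S \<subseteq> span B)"

text \<open>Complex dimension of a complex subspace = half its real dimension.\<close>
definition cdim :: "'a::complex_inner_space set \<Rightarrow> nat" where
  "cdim S = dim S div 2"

text \<open>Fredholm: bounded, closed range, finite-dimensional kernel and cokernel
  (the cokernel H / ran T of a closed-range operator is identified with the orthogonal complement of ran T).\<close>
definition fredholm :: "('a::complex_inner_space \<Rightarrow> 'a) \<Rightarrow> bool" where
  "fredholm T \<longleftrightarrow> bounded_clinear T \<and> closed (range T) \<and>
     fin_dim (ker_op T) \<and> fin_dim (orth_compl (range T))"

definition fredholm_index :: "('a::complex_inner_space \<Rightarrow> 'a) \<Rightarrow> int" where
  "fredholm_index T = int (cdim (ker_op T)) - int (cdim (orth_compl (range T)))"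

definition op_shift :: "('a::complex_inner_space \<Rightarrow> 'a) \<Rightarrow> complex \<Rightarrow> 'a \<Rightarrow> 'a" where
  "op_shift S l = (\<lambda>x. S x - scaleC l x)"

definition weyl_spectrum :: "('a::complex_inner_space \<Rightarrow> 'a) \<Rightarrow> complex set" where
  "weyl_spectrum S = {l. \<not> (fredholm (op_shift S l) \<and> fredholm_index (op_shift S l) = 0)}"

text \<open>R represents the inverse of \<pi>(A) in the Calkin algebra B(H)/K(H):
  AR - I and RA - I are compact.\<close>
definition calkin_inverse :: "('a::complex_inner_space \<Rightarrow> 'a) \<Rightarrow> ('a \<Rightarrow> 'a) \<Rightarrow> bool" where
  "calkin_inverse A R \<longleftrightarrow> bounded_clinear R \<and>
     compact_op (\<lambda>x. A (R x) - x) \<and> compact_op (\<lambda>x. R (A x) - x)"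

definition calkin_norm :: "('a::complex_inner_space \<Rightarrow> 'a) \<Rightarrow> real" where
  "calkin_norm A = Inf {onorm (\<lambda>x. A x + K x) | K. compact_op K}"

definition ess_spectrum :: "('a::complex_inner_space \<Rightarrow> 'a) \<Rightarrow> complex set" where
  "ess_spectrum S = {l. \<not> (\<exists>R. calkin_inverse (op_shift S l) R)}"

text \<open>Essentially G1: the norm of the Calkin resolvent equals 1/d(z, \<sigma>_e(S)).
  (The quotient norm does not depend on the chosen representative R.)\<close>
definition essentially_G1 :: "('a::complex_inner_space \<Rightarrow> 'a) \<Rightarrow> bool" where
  "essentially_G1 S \<longleftrightarrow> bounded_clinear S \<and>
     (\<forall>z. z \<notin> ess_spectrum S \<longrightarrow>
        (\<forall>R. calkin_inverse (op_shift S z) R \<longrightarrow>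
             calkin_norm R = 1 / infdist z (ess_spectrum S)))"

definition nu_converges :: "(nat \<Rightarrow> 'a::complex_inner_space \<Rightarrow> 'a) \<Rightarrow> ('a \<Rightarrow> 'a) \<Rightarrow> bool" where
  "nu_converges Tn T \<longleftrightarrow>
     (\<exists>M. \<forall>n. onorm (Tn n) \<le> M) \<and>
     (\<lambda>n. onorm (\<lambda>x. Tn n (T x) - T (T x))) \<longlonglongrightarrow> 0 \<and>
     (\<lambda>n. onorm (\<lambda>x. Tn n (Tn n x) - T (Tn n x))) \<longlonglongrightarrow> 0"

text \<open>Hausdorff distance (HOL Light convention: 0 unless both sets are nonempty and bounded).\<close>
definition hausdist :: "'a::metric_space set \<Rightarrow> 'a set \<Rightarrow> real" where
  "hausdist S T =
     (if S \<noteq> {} \<and> T \<noteq> {} \<and> bounded S \<and> bounded T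
      then max (SUP x\<in>S. infdist x T) (SUP y\<in>T. infdist y S) else 0)"

end

theory Submission
  imports Defs
begin

text \<open>
  Every vector of the closed range of \<open>T\<close> has a preimage of comparable norm (open mapping theorem), so
  \<open>\<parallel>(T\<^sub>n - T) T\<parallel> \<rightarrow> 0\<close> yields \<open>T\<^sub>n = T + B\<^sub>n + K\<^sub>n\<close> with \<open>\<parallel>B\<^sub>n\<parallel> \<rightarrow> 0\<close> and \<open>K\<^sub>n\<close> of finite rank.
  An operator is Fredholm of index zero iff it is an invertible operator plus a compact one; this class
  is stable under compact and under small perturbations, and a compactness argument gives upper
  semicontinuity of \<open>\<sigma>\<^sub>w\<close>.
  For lower semicontinuity let \<open>\<lambda> \<in> \<sigma>\<^sub>w(T)\<close> and suppose \<open>d(\<lambda>, \<sigma>\<^sub>w(T\<^sub>n)) > \<epsilon> \<ge> \<parallel>B\<^sub>n\<parallel>\<close>. Since \<open>\<sigma>\<^sub>e \<subseteq> \<sigma>\<^sub>w\<close>, the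
  essential \<open>G\<^sub>1\<close> condition gives \<open>\<parallel>(\<pi>(T\<^sub>n) - \<lambda>)\<inverse>\<parallel> < 1/\<epsilon>\<close>, and a Neumann series in the Calkin algebra
  shows that \<open>T - \<lambda>\<close> is Fredholm of index zero together with \<open>T\<^sub>n - \<lambda>\<close>, a contradiction.
\<close>

subsection \<open>Complex inner product spaces\<close>

lemma scaleC_zero_left [simp]: "scaleC 0 (x::'a::complex_vector_space) = 0"
  using scaleC_add_left[of 0 0 x] by simp

lemma scaleC_zero_right [simp]: "scaleC c (0::'a::complex_vector_space) = 0"
  using scaleC_add_right[of c 0 0] by simp

lemma scaleC_minus_left: "scaleC (- c) (x::'a::complex_vector_space) = - scaleC c x"
  using scaleC_add_left[of c "- c" x] by (simp add: eq_neg_iff_add_eq_0 add.commute)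

lemma scaleC_minus_right: "scaleC c (- x) = - scaleC c (x::'a::complex_vector_space)"
  using scaleC_add_right[of c x "- x"] by (simp add: eq_neg_iff_add_eq_0 add.commute)

lemma scaleC_diff_left: "scaleC (c - d) (x::'a::complex_vector_space) = scaleC c x - scaleC d x"
  using scaleC_add_left[of c "- d" x] by (simp add: scaleC_minus_left)

lemma scaleC_diff_right: "scaleC c (x - y) = scaleC c x - scaleC c (y::'a::complex_vector_space)"
  using scaleC_add_right[of c x "- y"] by (simp add: scaleC_minus_right)

lemma scaleC_scaleR: "scaleC c (r *\<^sub>R x) = r *\<^sub>R scaleC c (x::'a::complex_vector_space)"
  by (simp add: scaleR_scaleC scaleC_scaleC mult.commute)

lemma scaleC_Complex: "scaleC (Complex a b) x = a *\<^sub>R x + b *\<^sub>R scaleC \<i> (x::'a::complex_vector_space)"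
  unfolding Complex_eq scaleC_add_left by (simp add: scaleR_scaleC scaleC_scaleC mult.commute)

lemma cinner_add_right: "cinner x (y + z) = cinner x y + cinner x (z::'a::complex_inner_space)"
  by (metis cinner_add_left cinner_commute complex_cnj_add)

lemma cinner_scaleC_right: "cinner x (scaleC c y) = c * cinner x (y::'a::complex_inner_space)"
  by (metis cinner_commute cinner_scaleC_left complex_cnj_cnj complex_cnj_mult)

lemma cinner_zero_left [simp]: "cinner 0 (x::'a::complex_inner_space) = 0"
  using cinner_add_left[of 0 0 x] by simp

lemma cinner_zero_right [simp]: "cinner (x::'a::complex_inner_space) 0 = 0"
  using cinner_add_right[of x 0 0] by simp

lemma cinner_minus_left: "cinner (- x) y = - cinner x (y::'a::complex_inner_space)"
  using cinner_add_left[of x "- x" y] by (simp add: eq_neg_iff_add_eq_0 add.commute)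

lemma cinner_minus_right: "cinner x (- y) = - cinner x (y::'a::complex_inner_space)"
  using cinner_add_right[of x y "- y"] by (simp add: eq_neg_iff_add_eq_0 add.commute)

lemma cinner_diff_left: "cinner (x - y) z = cinner x z - cinner y (z::'a::complex_inner_space)"
  using cinner_add_left[of x "- y" z] by (simp add: cinner_minus_left)

lemma cinner_diff_right: "cinner x (y - z) = cinner x y - cinner x (z::'a::complex_inner_space)"
  using cinner_add_right[of x y "- z"] by (simp add: cinner_minus_right)

lemma cinner_scaleR_right: "cinner x (r *\<^sub>R y) = of_real r * cinner x (y::'a::complex_inner_space)"
  by (simp add: scaleR_scaleC cinner_scaleC_right)

lemma cinner_sum_right: "cinner x (\<Sum>i\<in>I. f i) = (\<Sum>i\<in>I. cinner x (f i :: 'a::complex_inner_space))"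
  by (induction I rule: infinite_finite_induct) (auto simp: cinner_add_right)

lemma cinner_sum_left: "cinner (\<Sum>i\<in>I. f i) x = (\<Sum>i\<in>I. cinner (f i :: 'a::complex_inner_space) x)"
  by (induction I rule: infinite_finite_induct) (auto simp: cinner_add_left)

section \<open>Norm identities and the Cauchy-Schwarz inequality\<close>

lemma cinner_self: "cinner x x = of_real ((norm (x::'a::complex_inner_space))\<^sup>2)"
proof -
  have "Im (cinner x x) = 0"
    using arg_cong[OF cinner_commute[of x x], of Im] by simp
  moreover have "Re (cinner x x) = (norm x)\<^sup>2"
    by (simp add: norm_eq_sqrt_cinner cinner_ge_zero)
  ultimately show ?thesis by (simp add: complex_eq_iff)
qed

lemma norm_scaleC [simp]: "norm (scaleC c x) = cmod c * norm (x::'a::complex_inner_space)"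
proof -
  have "complex_of_real ((norm (scaleC c x))\<^sup>2) = c * cnj c * cinner x x"
    by (simp only: cinner_self[symmetric] cinner_scaleC_left cinner_scaleC_right mult_ac)
  also have "\<dots> = of_real ((cmod c * norm x)\<^sup>2)"
    by (simp only: cinner_self complex_norm_square[symmetric] power_mult_distrib of_real_mult of_real_power)
  finally have "(norm (scaleC c x))\<^sup>2 = (cmod c * norm x)\<^sup>2"
    using of_real_eq_iff by blast
  then show ?thesis by (simp add: power2_eq_iff_nonneg)
qed

lemma norm_diff_square:
  "(norm (x - y))\<^sup>2 = (norm x)\<^sup>2 - 2 * Re (cinner x y) + (norm (y::'a::complex_inner_space))\<^sup>2"
proof -
  have "complex_of_real ((norm (x - y))\<^sup>2) = cinner x x - cinner x y - cinner y x + cinner y y"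
    unfolding cinner_self[symmetric] by (simp add: cinner_diff_left cinner_diff_right)
  then have "Re (complex_of_real ((norm (x - y))\<^sup>2))
      = Re (cinner x x) - Re (cinner x y) - Re (cinner y x) + Re (cinner y y)"
    by simp
  moreover have "Re (cinner y x) = Re (cinner x y)" by (subst cinner_commute) simp
  ultimately show ?thesis by (simp add: cinner_self del: of_real_power)
qed

lemma parallelogram_law:
  "(norm (x + y))\<^sup>2 + (norm (x - y))\<^sup>2 = 2 * (norm x)\<^sup>2 + 2 * (norm (y::'a::complex_inner_space))\<^sup>2"
  using norm_diff_square[of x y] norm_diff_square[of x "- y"] by (simp add: cinner_minus_right)

text \<open>Pythagoras for removing the component of \<open>x\<close> along \<open>e\<close>. It
  serves twice: nonnegativity of the left side gives Cauchy-Schwarz, and the strict decrease when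
  \<open>cinner e x\<close> is nonzero shows in \<open>orth_decomposition\<close> that a closest
  point has an orthogonal residual.\<close>

lemma norm_minus_component_square:
  fixes x e :: "'a::complex_inner_space"
  assumes "e \<noteq> 0"
  shows "(norm (x - scaleC (cinner e x / of_real ((norm e)\<^sup>2)) e))\<^sup>2
       = (norm x)\<^sup>2 - (cmod (cinner e x))\<^sup>2 / (norm e)\<^sup>2"
proof -
  let ?c = "cinner e x / of_real ((norm e)\<^sup>2)"
  have *: "cinner x (scaleC ?c e) = of_real ((cmod (cinner e x))\<^sup>2 / (norm e)\<^sup>2)"
    by (simp add: cinner_scaleC_right cinner_commute[of x e] complex_norm_square[symmetric]
        del: of_real_power)
  have "(norm (scaleC ?c e))\<^sup>2 = (cmod (cinner e x))\<^sup>2 / (norm e)\<^sup>2"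
    using assms by (simp add: norm_divide norm_power power_divide power_mult_distrib)
       (simp add: power2_eq_square power4_eq_xxxx)
  then show ?thesis
    unfolding norm_diff_square * by simp
qed

lemma Cauchy_Schwarz_cinner: "cmod (cinner x y) \<le> norm x * norm (y::'a::complex_inner_space)"
proof (cases "x = 0")
  case False
  have "0 \<le> (norm y)\<^sup>2 - (cmod (cinner x y))\<^sup>2 / (norm x)\<^sup>2"
    using norm_minus_component_square[OF False, of y] by (metis zero_le_power2)
  then have "(cmod (cinner x y))\<^sup>2 \<le> (norm x * norm y)\<^sup>2"
    using False by (simp add: field_simps power_mult_distrib)
  then show ?thesis by (simp add: power2_le_iff_abs_le)
qed simp

lemma bounded_linear_scaleC_left: "bounded_linear (\<lambda>c. scaleC c (x::'a::complex_inner_space))"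
  by (rule bounded_linear_intro[where K = "norm x"])
     (auto simp: scaleC_add_left scaleC_scaleC scaleR_scaleC scaleC_complex_def)

subsection \<open>Bounded complex-linear operators\<close>

lemma bounded_clinear_intro:
  assumes "\<And>x y. f (x + y) = f x + f y" "\<And>c x. f (scaleC c x) = scaleC c (f x)"
    "\<And>x. norm (f x) \<le> K * norm x"
  shows "bounded_clinear f"
  unfolding bounded_clinear_def
  by (intro conjI bounded_linear_intro[where K = K] allI) (auto simp: assms scaleR_scaleC mult.commute)

lemma bounded_clinear_bounded_linear: "bounded_clinear f \<Longrightarrow> bounded_linear f"
  by (simp add: bounded_clinear_def)

lemma bounded_clinear_linear: "bounded_clinear f \<Longrightarrow> linear f"
  by (simp add: bounded_clinear_def bounded_linear.linear)

lemma bounded_clinear_scaleC: "bounded_clinear f \<Longrightarrow> f (scaleC c x) = scaleC c (f x)"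
  by (simp add: bounded_clinear_def)

lemma bounded_clinear_add_apply: "bounded_clinear f \<Longrightarrow> f (x + y) = f x + f y"
  by (simp add: bounded_clinear_linear linear_add)

lemma bounded_clinear_diff_apply: "bounded_clinear f \<Longrightarrow> f (x - y) = f x - f y"
  by (simp add: bounded_clinear_linear linear_diff)

lemma bounded_clinear_zero_apply: "bounded_clinear f \<Longrightarrow> f 0 = 0"
  by (simp add: bounded_clinear_linear linear_0)

lemma bounded_clinear_bound:
  assumes "bounded_clinear f"
  obtains K where "K > 0" "\<And>x. norm (f x) \<le> K * norm x"
  using bounded_linear.pos_bounded[OF bounded_clinear_bounded_linear[OF assms]]
  by (metis mult.commute)

lemma bounded_clinear_ident: "bounded_clinear (\<lambda>x. x)"
  by (simp add: bounded_clinear_def bounded_linear_ident)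

lemma bounded_clinear_zero: "bounded_clinear (\<lambda>x. 0)"
  by (simp add: bounded_clinear_def bounded_linear_zero)

lemma bounded_clinear_add:
  "bounded_clinear f \<Longrightarrow> bounded_clinear g \<Longrightarrow> bounded_clinear (\<lambda>x. f x + g x)"
  by (simp add: bounded_clinear_def bounded_linear_add scaleC_add_right)

lemma bounded_clinear_diff:
  "bounded_clinear f \<Longrightarrow> bounded_clinear g \<Longrightarrow> bounded_clinear (\<lambda>x. f x - g x)"
  by (simp add: bounded_clinear_def bounded_linear_sub scaleC_diff_right)

lemma bounded_clinear_compose:
  "bounded_clinear f \<Longrightarrow> bounded_clinear g \<Longrightarrow> bounded_clinear (\<lambda>x. f (g x))"
  by (simp add: bounded_clinear_def bounded_linear_compose)

lemma bounded_clinear_const_scaleC: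
  assumes "bounded_clinear f" shows "bounded_clinear (\<lambda>x. scaleC c (f x))"
proof -
  obtain K where K: "\<And>x. norm (f x) \<le> K * norm x" using bounded_clinear_bound[OF assms] by blast
  show ?thesis
  proof (rule bounded_clinear_intro[where K = "cmod c * K"])
    show "norm (scaleC c (f x)) \<le> cmod c * K * norm x" for x
      using mult_left_mono[OF K, of "cmod c" x] by (simp add: mult.assoc)
  qed (use assms in \<open>simp_all add: bounded_clinear_add_apply bounded_clinear_scaleC
         scaleC_add_right scaleC_scaleC mult.commute\<close>)
qed

lemma bounded_clinear_sum:
  "(\<And>i. i \<in> I \<Longrightarrow> bounded_clinear (f i)) \<Longrightarrow> bounded_clinear (\<lambda>x. \<Sum>i\<in>I. f i x)"
  by (induction I rule: infinite_finite_induct) (auto intro: bounded_clinear_add bounded_clinear_zero)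

lemma bounded_clinear_rank_one:
  assumes "bounded_clinear f" shows "bounded_clinear (\<lambda>x. scaleC (cinner a (f x)) b)"
proof -
  obtain K where K: "\<And>x. norm (f x) \<le> K * norm x" using bounded_clinear_bound[OF assms] by blast
  show ?thesis
  proof (rule bounded_clinear_intro[where K = "norm a * K * norm b"])
    fix x
    have "cmod (cinner a (f x)) \<le> norm a * (K * norm x)"
      by (rule order_trans[OF Cauchy_Schwarz_cinner mult_left_mono[OF K]]) simp
    then show "norm (scaleC (cinner a (f x)) b) \<le> norm a * K * norm b * norm x"
      using mult_right_mono[of _ _ "norm b"] by (fastforce simp: mult_ac)
  qed (use assms in \<open>simp_all add: bounded_clinear_add_apply bounded_clinear_scaleC
         cinner_add_right cinner_scaleC_right scaleC_add_left scaleC_scaleC\<close>)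
qed

lemma bounded_clinear_op_shift: "bounded_clinear S \<Longrightarrow> bounded_clinear (op_shift S l)"
  unfolding op_shift_def
  by (intro bounded_clinear_diff bounded_clinear_const_scaleC bounded_clinear_ident)

subsection \<open>Orthonormal bases of finite-dimensional subspaces\<close>

definition csubspace :: "'a::complex_inner_space set \<Rightarrow> bool" where
  "csubspace S \<longleftrightarrow> subspace S \<and> (\<forall>c. \<forall>x\<in>S. scaleC c x \<in> S)"

definition orthonormal :: "'a::complex_inner_space set \<Rightarrow> bool" where
  "orthonormal E \<longleftrightarrow> (\<forall>x\<in>E. \<forall>y\<in>E. cinner x y = (if x = y then 1 else 0))"

text \<open>This is the orthogonal projection onto the complex span of \<open>E\<close> only when
  \<open>E\<close> is finite and orthonormal; for infinite \<open>E\<close> the sum takes its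
  default value 0.\<close>

definition orth_proj :: "'a::complex_inner_space set \<Rightarrow> 'a \<Rightarrow> 'a" where
  "orth_proj E x = (\<Sum>e\<in>E. scaleC (cinner e x) e)"

lemma csubspace_range: "bounded_clinear f \<Longrightarrow> csubspace (range f)"
  unfolding csubspace_def
  by (auto simp: bounded_clinear_scaleC[symmetric] intro!: linear_subspace_image bounded_clinear_linear)

lemma csubspace_ker_op: "bounded_clinear f \<Longrightarrow> csubspace (ker_op f)"
  unfolding csubspace_def ker_op_def
  by (auto simp: bounded_clinear_scaleC intro!: linear_subspace_kernel bounded_clinear_linear)

lemma csubspace_orth_compl: "csubspace (orth_compl S)"
  unfolding csubspace_def orth_compl_def subspace_def
  by (auto simp: cinner_add_right cinner_scaleC_right cinner_scaleR_right)

lemma csubspace_mem_orth_proj: "csubspace S \<Longrightarrow> E \<subseteq> S \<Longrightarrow> orth_proj E x \<in> S"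
  unfolding orth_proj_def csubspace_def by (intro subspace_sum) auto

lemma bounded_clinear_orth_proj: "bounded_clinear (orth_proj E)"
  unfolding orth_proj_def
  by (intro bounded_clinear_sum bounded_clinear_rank_one[OF bounded_clinear_ident])

lemma cinner_orth_proj:
  assumes "orthonormal E" "finite E" "e \<in> E"
  shows "cinner e (orth_proj E x) = cinner e x"
proof -
  have "cinner e (orth_proj E x) = (\<Sum>f\<in>E. if f = e then cinner e x else 0)"
    unfolding orth_proj_def cinner_sum_right
    by (rule sum.cong) (use assms in \<open>auto simp: orthonormal_def cinner_scaleC_right\<close>)
  then show ?thesis using assms by simp
qed

text \<open>\<open>span\<close>, \<open>dim\<close> and \<open>independent\<close> are taken over
  the reals, so a complex basis \<open>E\<close> has to be doubled to \<open>E\<close> together with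
  i times \<open>E\<close>. Pairing the real coefficients of e and of i e into one complex number
  and taking the inner product with e shows that each of them vanishes.\<close>

lemma orthonormal_independent_cpx:
  assumes E: "orthonormal E" "finite E"
  shows "independent (E \<union> scaleC \<i> ` E)" "card (E \<union> scaleC \<i> ` E) = 2 * card E"
proof -
  have inj: "inj_on (scaleC \<i>) E"
  proof (rule inj_onI)
    fix x y assume "scaleC \<i> x = scaleC \<i> y"
    then have "scaleC (- \<i>) (scaleC \<i> x) = scaleC (- \<i>) (scaleC \<i> y)" by simp
    then show "x = y" by (simp add: scaleC_scaleC scaleC_one)
  qed
  \<comment> \<open>A common element would make an inner product of two members of \<open>E\<close>
    equal to i, while only 0 and 1 occur.\<close>
  have disj: "E \<inter> scaleC \<i> ` E = {}"
  proof (rule ccontr)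
    assume "E \<inter> scaleC \<i> ` E \<noteq> {}"
    then obtain x y where xy: "x \<in> E" "y \<in> E" "y = scaleC \<i> x" by blast
    have "cinner x y = \<i> * cinner x x" using xy by (simp add: cinner_scaleC_right)
    then show False using E xy(1,2) by (auto simp: orthonormal_def split: if_splits)
  qed
  show "card (E \<union> scaleC \<i> ` E) = 2 * card E"
    using disj inj E(2) by (simp add: card_Un_disjoint card_image)
  show "independent (E \<union> scaleC \<i> ` E)"
  proof (rule independent_if_scalars_zero)
    fix u x assume 0: "(\<Sum>x\<in>E \<union> scaleC \<i> ` E. u x *\<^sub>R x) = 0" and x: "x \<in> E \<union> scaleC \<i> ` E"
    have "0 = (\<Sum>x\<in>E. u x *\<^sub>R x) + (\<Sum>x\<in>E. u (scaleC \<i> x) *\<^sub>R scaleC \<i> x)"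
      using 0 disj E(2) inj by (simp add: sum.union_disjoint sum.reindex)
    also have "\<dots> = (\<Sum>x\<in>E. scaleC (Complex (u x) (u (scaleC \<i> x))) x)"
      by (simp add: sum.distrib scaleC_Complex)
    finally have s: "(\<Sum>x\<in>E. scaleC (Complex (u x) (u (scaleC \<i> x))) x) = 0" by simp
    have z: "Complex (u e) (u (scaleC \<i> e)) = 0" if e: "e \<in> E" for e
    proof -
      have "0 = cinner e (\<Sum>x\<in>E. scaleC (Complex (u x) (u (scaleC \<i> x))) x)" by (simp add: s)
      also have "\<dots> = (\<Sum>x\<in>E. if x = e then Complex (u e) (u (scaleC \<i> e)) else 0)"
        unfolding cinner_sum_right
        by (rule sum.cong) (use E e in \<open>auto simp: orthonormal_def cinner_scaleC_right\<close>)
      finally show ?thesis using e E(2) by simp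
    qed
    then show "u x = 0" using x by (auto simp: complex_eq_iff)
  qed (use E in simp)
qed

lemma orthonormal_card_le:
  assumes E: "orthonormal E" "finite B" "E \<subseteq> span B"
  shows "finite E \<and> card E \<le> card B"
proof -
  have *: "card D \<le> card B" if "D \<subseteq> E" "finite D" for D
  proof -
    have "orthonormal D" using E(1) that(1) unfolding orthonormal_def by blast
    then have "independent D"
      by (rule independent_mono[OF orthonormal_independent_cpx(1)[OF _ that(2)] Un_upper1])
    from independent_span_bound[OF E(2) this subset_trans[OF that(1) E(3)]] show ?thesis by simp
  qed
  have "finite E"
  proof (rule ccontr)
    assume "infinite E"
    then obtain D where "finite D" "card D = Suc (card B)" "D \<subseteq> E"
      using infinite_arbitrarily_large by blast
    with *[of D] show False by simp
  qed
  with * show ?thesis by blast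
qed

lemma orth_proj_orthogonal:
  assumes "orthonormal E" "finite E" "e \<in> E"
  shows "cinner e (x - orth_proj E x) = 0"
  using cinner_orth_proj[OF assms] by (simp add: cinner_diff_right)

lemma orth_proj_mem_span: "orth_proj E x \<in> span (E \<union> scaleC \<i> ` E)"
  unfolding orth_proj_def
proof (rule span_sum)
  fix e assume "e \<in> E"
  have "scaleC (cinner e x) e = Re (cinner e x) *\<^sub>R e + Im (cinner e x) *\<^sub>R scaleC \<i> e"
    using scaleC_Complex[of "Re (cinner e x)" "Im (cinner e x)" e] by simp
  moreover have "e \<in> span (E \<union> scaleC \<i> ` E)" "scaleC \<i> e \<in> span (E \<union> scaleC \<i> ` E)"
    using \<open>e \<in> E\<close> by (auto intro: span_base)
  ultimately show "scaleC (cinner e x) e \<in> span (E \<union> scaleC \<i> ` E)"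
    by (simp add: span_add span_scale)
qed

text \<open>An orthonormal subset of \<open>S\<close> of greatest cardinality works;
  \<open>orthonormal_card_le\<close> bounds these cardinalities. If the projection moved some x in
  \<open>S\<close>, the normalised residual could be added to the set. The last conclusion shows
  that the real dimension is even, so that the division by 2 in \<open>cdim\<close> is
  exact.\<close>

lemma orthonormal_basis_exists:
  assumes S: "csubspace S" and fd: "fin_dim S"
  obtains E where "finite E" "orthonormal E" "E \<subseteq> S" "\<And>x. x \<in> S \<Longrightarrow> orth_proj E x = x"
    "dim S = 2 * card E"
proof -
  obtain B where B: "finite B" "S \<subseteq> span B" using fd by (auto simp: fin_dim_def)
  let ?P = "\<lambda>E. orthonormal E \<and> E \<subseteq> S"
  have ub: "finite E \<and> card E \<le> card B" if "?P E" for E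
    using orthonormal_card_le[of E B] that B by blast
  have "?P {}" by (simp add: orthonormal_def)
  moreover have "\<forall>E. ?P E \<longrightarrow> card E < Suc (card B)" using ub by (simp add: less_Suc_eq_le)
  ultimately obtain E where E: "?P E" and max: "\<And>D. ?P D \<Longrightarrow> card D \<le> card E"
    using ex_has_greatest_nat[of ?P "{}" card "Suc (card B)"] by blast
  have fin: "finite E" using ub E by blast
  have sub: "subspace S" using S by (simp add: csubspace_def)
  have eq: "orth_proj E x = x" if x: "x \<in> S" for x
  proof (rule ccontr)
    assume neq: "orth_proj E x \<noteq> x"
    let ?z = "x - orth_proj E x"
    define d where "d = scaleC (1 / of_real (norm ?z)) ?z"
    have zS: "?z \<in> S" using sub x csubspace_mem_orth_proj[OF S] E by (blast intro: subspace_diff)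
    have dS: "d \<in> S" using S zS unfolding d_def csubspace_def by blast
    have "norm d = 1" using neq by (simp add: d_def norm_divide)
    then have dd: "cinner d d = 1" by (simp add: cinner_self)
    have ed: "cinner e d = 0" if "e \<in> E" for e
      using orth_proj_orthogonal[OF _ fin that] E by (simp add: d_def cinner_scaleC_right)
    then have de: "cinner d e = 0" if "e \<in> E" for e
      by (subst cinner_commute) (simp add: that)
    have "d \<notin> E" using ed dd by force
    have "?P (insert d E)"
      using E ed de dd dS \<open>d \<notin> E\<close> by (auto simp: orthonormal_def)
    from max[OF this] show False using fin \<open>d \<notin> E\<close> by simp
  qed
  have "dim S = card (E \<union> scaleC \<i> ` E)"
  proof (rule dim_unique)
    show "E \<union> scaleC \<i> ` E \<subseteq> S" using E S by (auto simp: csubspace_def)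
    show "S \<subseteq> span (E \<union> scaleC \<i> ` E)"
    proof
      fix x assume "x \<in> S"
      show "x \<in> span (E \<union> scaleC \<i> ` E)"
        using orth_proj_mem_span[of E x] eq[OF \<open>x \<in> S\<close>] by simp
    qed
  qed (use orthonormal_independent_cpx E fin in auto)
  then have "dim S = 2 * card E" using orthonormal_independent_cpx(2)[OF conjunct1[OF E] fin] by simp
  then show ?thesis using that[OF fin conjunct1[OF E] conjunct2[OF E] eq] by blast
qed

text \<open>Best approximation: the residual of \<open>x\<close> is orthogonal to
  \<open>z - orth_proj E x\<close>, which lies in the range of the projection, so Pythagoras
  applies.\<close>

lemma norm_diff_orth_proj_le:
  assumes E: "orthonormal E" "finite E" and z: "orth_proj E z = z"
  shows "norm (x - orth_proj E x) \<le> norm (x - z)"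
proof -
  let ?u = "x - orth_proj E x" and ?v = "z - orth_proj E x"
  have v: "?v = orth_proj E (z - x)"
    using z by (simp add: bounded_clinear_diff_apply[OF bounded_clinear_orth_proj])
  have "cinner ?v ?u = (\<Sum>e\<in>E. cnj (cinner e (z - x)) * cinner e ?u)"
    unfolding v by (subst orth_proj_def) (simp add: cinner_sum_left cinner_scaleC_left)
  also have "\<dots> = 0" using orth_proj_orthogonal[OF E] by simp
  finally have "cinner ?u ?v = 0" by (subst cinner_commute) simp
  then have "(norm (?u - ?v))\<^sup>2 = (norm ?u)\<^sup>2 + (norm ?v)\<^sup>2" by (subst norm_diff_square) simp
  moreover have "?u - ?v = x - z" by simp
  ultimately have "(norm ?u)\<^sup>2 \<le> (norm (x - z))\<^sup>2" by simp
  then show ?thesis by (simp add: power2_le_iff_abs_le)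
qed

text \<open>The subspace is the fixed-point set of a continuous projection.\<close>

lemma fin_dim_csubspace_closed:
  assumes "csubspace S" "fin_dim S" shows "closed S"
proof -
  obtain E where E: "E \<subseteq> S" "\<And>x. x \<in> S \<Longrightarrow> orth_proj E x = x"
    using orthonormal_basis_exists[OF assms] by metis
  have "S = {x. orth_proj E x = x}"
  proof (intro set_eqI iffI)
    show "x \<in> S" if "x \<in> {x. orth_proj E x = x}" for x
      using csubspace_mem_orth_proj[OF assms(1) E(1), of x] that by simp
  qed (use E in auto)
  moreover have "continuous_on UNIV (orth_proj E)"
    by (simp add: bounded_clinear_bounded_linear bounded_clinear_orth_proj linear_continuous_on)
  ultimately show ?thesis using closed_Collect_eq[of "orth_proj E" "\<lambda>x. x"] by simp
qed

subsection \<open>The projection theorem\<close>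

lemma closest_point_exists:
  fixes S :: "'a::{complex_inner_space, complete_space} set"
  assumes "closed S" "subspace S"
  obtains p where "p \<in> S" "\<And>y. y \<in> S \<Longrightarrow> norm (x - p) \<le> norm (x - y)"
proof -
  have ne: "S \<noteq> {}" using assms(2) subspace_0 by blast
  define d where "d = infdist x S"
  have d0: "d \<ge> 0" by (simp add: d_def infdist_nonneg)
  have dle: "d \<le> norm (x - y)" if "y \<in> S" for y
    using infdist_le[OF that, of x] by (simp add: d_def dist_norm)
  have "\<exists>y\<in>S. norm (x - y) < d + 1 / Suc n" for n
  proof -
    have "infdist x S < d + 1 / Suc n" by (simp add: d_def)
    then show ?thesis unfolding infdist_notempty[OF ne]
      by (subst (asm) cINF_less_iff) (use ne in \<open>auto simp: dist_norm intro: bdd_belowI2[of _ 0]\<close>)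
  qed
  then obtain y where y: "\<And>n. y n \<in> S" "\<And>n::nat. norm (x - y n) < d + 1 / Suc n" by metis
  \<comment> \<open>The parallelogram law for \<open>x - y m\<close> and \<open>x - y n\<close>,
    whose half sum is \<open>x\<close> minus a midpoint in \<open>S\<close> and so has norm at least
    \<open>d\<close>. The factor \<open>2 * d + 1\<close> bounds the excess of the square of
    \<open>d + 1 / Suc k\<close> over the square of \<open>d\<close>, and 4 is the sum of the two
    factors 2 in the law.\<close>
  have key: "(norm (y m - y n))\<^sup>2 \<le> 4 * (2 * d + 1) * (1 / Suc k)" if "k \<le> m" "k \<le> n" for k m n
  proof -
    have b: "(norm (x - y j))\<^sup>2 \<le> d\<^sup>2 + (2 * d + 1) * (1 / Suc k)" if "k \<le> j" for j
    proof -
      have "1 / real (Suc j) \<le> 1 / Suc k" using that by (simp add: frac_le)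
      then have "norm (x - y j) \<le> d + 1 / Suc k" using y(2)[of j] by linarith
      then have "(norm (x - y j))\<^sup>2 \<le> (d + 1 / Suc k)\<^sup>2" by (rule power_mono) simp
      also have "\<dots> = d\<^sup>2 + 2 * d * (1 / Suc k) + (1 / Suc k) * (1 / Suc k)"
        by (simp add: power2_eq_square algebra_simps)
      also have "(1 / real (Suc k)) * (1 / Suc k) \<le> 1 * (1 / Suc k)"
        by (rule mult_right_mono) auto
      finally show ?thesis by (simp add: algebra_simps)
    qed
    have mid: "(1/2) *\<^sub>R (y m + y n) \<in> S" using assms(2) y(1) by (intro subspace_scale subspace_add)
    have "(x - y m) + (x - y n) = 2 *\<^sub>R (x - (1/2) *\<^sub>R (y m + y n))"
      by (simp add: algebra_simps scaleR_2)
    then have "(norm ((x - y m) + (x - y n)))\<^sup>2 = 4 * (norm (x - (1/2) *\<^sub>R (y m + y n)))\<^sup>2"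
      by (simp add: power_mult_distrib)
    moreover have "d\<^sup>2 \<le> (norm (x - (1/2) *\<^sub>R (y m + y n)))\<^sup>2"
      using dle[OF mid] d0 by (rule power_mono)
    moreover have "(x - y m) - (x - y n) = y n - y m" by simp
    ultimately have "(norm (y n - y m))\<^sup>2 \<le> 2 * (norm (x - y m))\<^sup>2 + 2 * (norm (x - y n))\<^sup>2 - 4 * d\<^sup>2"
      using parallelogram_law[of "x - y m" "x - y n"] by simp
    then have "(norm (y n - y m))\<^sup>2 \<le> 4 * ((2 * d + 1) * (1 / Suc k))"
      using b[OF that(1)] b[OF that(2)] by linarith
    then show ?thesis by (subst norm_minus_commute) (simp only: mult.assoc)
  qed
  have "Cauchy y"
  proof (rule metric_CauchyI)
    fix e :: real assume e: "e > 0"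
    have "e\<^sup>2 / (4 * (2 * d + 1)) > 0" using e d0 by simp
    then obtain k :: nat where k: "1 / Suc k < e\<^sup>2 / (4 * (2 * d + 1))"
      using nat_approx_posE by blast
    have "4 * (2 * d + 1) * (1 / Suc k) < 4 * (2 * d + 1) * (e\<^sup>2 / (4 * (2 * d + 1)))"
      using k d0 by (intro mult_strict_left_mono) auto
    also have "\<dots> = e\<^sup>2" using d0 by simp
    finally have kk: "4 * (2 * d + 1) * (1 / Suc k) < e\<^sup>2" .
    have "dist (y m) (y n) < e" if "k \<le> m" "k \<le> n" for m n
    proof -
      have "(norm (y m - y n))\<^sup>2 < e\<^sup>2" using key[OF that] kk by linarith
      then show ?thesis using e by (simp add: dist_norm power2_less_imp_less)
    qed
    then show "\<exists>M. \<forall>m\<ge>M. \<forall>n\<ge>M. dist (y m) (y n) < e" by blast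
  qed
  then obtain p where p: "y \<longlonglongrightarrow> p" using Cauchy_convergent convergent_def by blast
  have "p \<in> S" using assms(1) y(1) p closed_sequentially by blast
  moreover have "norm (x - p) \<le> d"
  proof (rule LIMSEQ_le)
    show "(\<lambda>n. norm (x - y n)) \<longlonglongrightarrow> norm (x - p)" by (intro tendsto_intros p)
    show "(\<lambda>n. d + 1 / Suc n) \<longlonglongrightarrow> d"
      using tendsto_add[OF tendsto_const[of d] LIMSEQ_Suc[OF lim_1_over_n]] by simp
    show "\<exists>N. \<forall>n\<ge>N. norm (x - y n) \<le> d + 1 / Suc n" using y(2) less_imp_le by blast
  qed
  ultimately show ?thesis using that[of p] order_trans[OF _ dle] by blast
qed

text \<open>Take the closest point \<open>p\<close>. If \<open>x - p\<close> had a nonzero component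
  along some r in \<open>S\<close>, moving \<open>p\<close> by that component would stay in
  \<open>S\<close> and reduce the distance.\<close>

lemma orth_decomposition:
  fixes S :: "'a::{complex_inner_space, complete_space} set"
  assumes "closed S" "csubspace S"
  obtains p where "p \<in> S" "x - p \<in> orth_compl S"
proof -
  have sub: "subspace S" using assms(2) by (simp add: csubspace_def)
  obtain p where p: "p \<in> S" "\<And>y. y \<in> S \<Longrightarrow> norm (x - p) \<le> norm (x - y)"
    using closest_point_exists[OF assms(1) sub] by blast
  have "cinner r (x - p) = 0" if r: "r \<in> S" for r
  proof (cases "r = 0")
    case False
    let ?c = "cinner r (x - p) / of_real ((norm r)\<^sup>2)"
    have "p + scaleC ?c r \<in> S" using assms(2) p(1) r sub by (auto simp: csubspace_def subspace_add)
    then have "(norm (x - p))\<^sup>2 \<le> (norm (x - (p + scaleC ?c r)))\<^sup>2"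
      using p(2) by (intro power_mono) auto
    also have "x - (p + scaleC ?c r) = (x - p) - scaleC ?c r" by simp
    finally have "(cmod (cinner r (x - p)))\<^sup>2 / (norm r)\<^sup>2 \<le> 0"
      unfolding norm_minus_component_square[OF False] by simp
    then show ?thesis using False by (simp add: divide_le_0_iff power2_eq_square mult_le_0_iff)
  qed simp
  then show ?thesis using that p(1) by (simp add: orth_compl_def)
qed

lemma orth_compl_orth_proj_zero:
  assumes "E \<subseteq> orth_compl S" "x \<in> S" shows "orth_proj E x = 0"
proof -
  have "cinner e x = 0" if "e \<in> E" for e
  proof -
    have "cinner x e = 0" using assms that by (auto simp: orth_compl_def)
    then show ?thesis by (subst cinner_commute) simp
  qed
  then show ?thesis by (simp add: orth_proj_def)
qed

text \<open>Split \<open>x\<close> into a part in \<open>S\<close> and a part in its orthogonal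
  complement: the projection kills the first and fixes the second. For a closed \<open>S\<close> of
  finite codimension this realises the projection onto \<open>S\<close> as the identity minus a
  finite-rank operator.\<close>

lemma diff_orth_proj_mem:
  fixes S :: "'a::{complex_inner_space, complete_space} set"
  assumes S: "closed S" "csubspace S"
    and E: "\<And>x. x \<in> orth_compl S \<Longrightarrow> orth_proj E x = x" "E \<subseteq> orth_compl S"
  shows "x - orth_proj E x \<in> S"
proof -
  obtain p where p: "p \<in> S" "x - p \<in> orth_compl S" using orth_decomposition[OF S] by blast
  have "orth_proj E p = 0" by (rule orth_compl_orth_proj_zero[OF E(2) p(1)])
  moreover have "orth_proj E (x - p) = x - p" using E(1) p(2) by blast
  ultimately have "orth_proj E x = x - p"
    by (simp add: bounded_clinear_diff_apply[OF bounded_clinear_orth_proj])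
  then show ?thesis using p(1) by simp
qed

subsection \<open>Rank and nullity\<close>

lemma fin_dim_subset: "fin_dim T \<Longrightarrow> S \<subseteq> T \<Longrightarrow> fin_dim S"
  unfolding fin_dim_def by (meson subset_trans)

lemma fin_dim_linear_image:
  assumes "linear f" "fin_dim S" shows "fin_dim (f ` S)"
proof -
  obtain B where "finite B" "S \<subseteq> span B" using assms(2) by (auto simp: fin_dim_def)
  then have "finite (f ` B)" "f ` S \<subseteq> span (f ` B)"
    using linear_spans_image[OF assms(1)] by auto
  then show ?thesis unfolding fin_dim_def by blast
qed

lemma independent_span_disjoint:
  assumes C: "independent C" "finite C" "B \<subseteq> C" and x: "x \<in> span B" "x \<in> span (C - B)"
  shows "x = 0"
proof -
  have fB: "finite B" "finite (C - B)" using C finite_subset by auto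
  obtain u where u: "x = (\<Sum>b\<in>B. u b *\<^sub>R b)" using x(1) fB(1) by (auto simp: span_finite)
  obtain v where v: "x = (\<Sum>b\<in>C - B. v b *\<^sub>R b)" using x(2) fB(2) by (auto simp: span_finite)
  let ?w = "\<lambda>c. if c \<in> B then u c else - v c"
  have "(\<Sum>c\<in>C. ?w c *\<^sub>R c) = (\<Sum>c\<in>C - B. ?w c *\<^sub>R c) + (\<Sum>c\<in>B. ?w c *\<^sub>R c)"
    by (rule sum.subset_diff[OF C(3,2)])
  also have "(\<Sum>c\<in>B. ?w c *\<^sub>R c) = x" unfolding u by (rule sum.cong) auto
  also have "(\<Sum>c\<in>C - B. ?w c *\<^sub>R c) = - x"
    unfolding v sum_negf[symmetric] by (rule sum.cong) auto
  finally have "(\<Sum>c\<in>C. ?w c *\<^sub>R c) = 0" by simp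
  then have "?w c = 0" if "c \<in> C" for c
    using independentD[OF C(1,2) subset_refl _ that, of ?w] by simp
  then have "u b = 0" if "b \<in> B" for b using that C(3) by (metis subsetD)
  then show ?thesis using u by simp
qed

text \<open>Rank-nullity where only \<open>S\<close>, not the ambient space, is finite-dimensional.
  A basis \<open>B\<close> of the kernel in \<open>S\<close> is extended to a basis \<open>C\<close>
  of \<open>S\<close>; \<open>f\<close> is injective on the span of \<open>C - B\<close>, and the
  images of these vectors span the image of \<open>S\<close>.\<close>

lemma dim_image_plus_dim_kernel:
  fixes f :: "'a::real_vector \<Rightarrow> 'b::real_vector"
  assumes f: "linear f" and S: "subspace S" "fin_dim S"
  shows "dim S = dim (f ` S) + dim {x \<in> S. f x = 0}"
proof -
  let ?N = "{x \<in> S. f x = 0}"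
  obtain D where D: "finite D" "S \<subseteq> span D" using S(2) by (auto simp: fin_dim_def)
  obtain B where B: "B \<subseteq> ?N" "independent B" "?N \<subseteq> span B" "card B = dim ?N"
    by (rule basis_exists)
  have BS: "B \<subseteq> S" using B(1) by auto
  obtain C where C: "B \<subseteq> C" "C \<subseteq> S" "independent C" "S \<subseteq> span C"
    by (rule maximal_independent_subset_extend[OF BS B(2)])
  have fC: "finite C" using independent_span_bound[OF D(1) C(3)] C(2) D(2) by auto
  have "dim S = card C" by (rule dim_unique[OF C(2,4,3) refl])
  have inj: "inj_on f (span (C - B))"
    unfolding linear_inj_on_iff_eq_0[OF f subspace_span]
  proof (intro ballI impI)
    fix x assume x: "x \<in> span (C - B)" "f x = 0"
    have "span (C - B) \<subseteq> S" using C(2) S(1) by (intro span_minimal) auto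
    then have "x \<in> span B" using x B(3) by auto
    then show "x = 0" using independent_span_disjoint[OF C(3) fC C(1)] x(1) by simp
  qed
  have "dim (f ` S) = card (f ` (C - B))"
  proof (rule dim_unique[OF _ _ _ refl])
    show "f ` (C - B) \<subseteq> f ` S" using C(2) by auto
    have "independent (C - B)" by (rule independent_mono[OF C(3)]) auto
    then show "independent (f ` (C - B))"
      by (rule linear_independent_injective_image[OF f _ inj])
    have "f ` S \<subseteq> span (f ` C)" by (rule linear_spans_image[OF f C(4)])
    also have "\<dots> \<subseteq> span (f ` (C - B))"
    proof (rule span_minimal[OF _ subspace_span], safe)
      fix c assume "c \<in> C"
      show "f c \<in> span (f ` (C - B))"
      proof (cases "c \<in> B")
        case True
        then have "f c = 0" using B(1) by auto
        then show ?thesis by (simp add: span_zero)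
      next
        case False
        then show ?thesis using \<open>c \<in> C\<close> by (intro span_base) auto
      qed
    qed
    finally show "f ` S \<subseteq> span (f ` (C - B))" .
  qed
  also have "\<dots> = card (C - B)"
    by (rule card_image) (rule inj_on_subset[OF inj], rule span_superset)
  also have "\<dots> = card C - card B" using C(1) fC by (simp add: card_Diff_subset finite_subset)
  finally show ?thesis
    using \<open>dim S = card C\<close> B(4) card_mono[OF fC C(1)] by simp
qed

subsection \<open>The open mapping theorem for closed range\<close>

text \<open>Baire category in the complete space \<open>range f\<close>: the closures of the images
  of balls cover it, so one of them contains a relative ball around some \<open>y0\<close>.
  Subtracting approximations of \<open>y0\<close> and of a point near \<open>y0\<close> moves the
  estimate to the origin.\<close>

lemma bounded_linear_closed_range_approx_preimage:
  fixes f :: "'a::real_normed_vector \<Rightarrow> 'b::{real_normed_vector, complete_space}"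
  assumes f: "bounded_linear f" and R: "closed (range f)"
  obtains c where "c > 0"
    "\<And>y. y \<in> range f \<Longrightarrow> \<exists>x. norm x \<le> c * norm y \<and> norm (y - f x) \<le> norm y / 2"
proof -
  have lin: "linear f" using f bounded_linear.linear by blast
  have sub: "subspace (range f)" using linear_subspace_image[OF lin subspace_UNIV] .
  let ?X = "top_of_set (range f)"
  let ?T = "\<lambda>n::nat. range f \<inter> closure (f ` ball 0 (real n))"
  have "\<exists>n. ?X interior_of ?T n \<noteq> {}"
  proof (rule ccontr)
    assume "\<not> ?thesis"
    then have e: "?X interior_of ?T n = {}" for n by blast
    have "?X interior_of \<Union>(range ?T) = {}"
    proof (rule Baire_category_alt)
      show "completely_metrizable_space ?X \<or> locally_compact_space ?X \<and> regular_space ?X"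
        using completely_metrizable_space_closedin[OF completely_metrizable_space_euclidean]
          R[unfolded closed_closedin] by blast
      show "countable (range ?T)" by simp
      show "closedin ?X T \<and> ?X interior_of T = {}" if T: "T \<in> range ?T" for T
      proof -
        obtain n where "T = ?T n" using T by (rule imageE)
        then show ?thesis using e[of n] closedin_closed_Int[OF closed_closure] by simp
      qed
    qed
    moreover have "\<Union>(range ?T) = range f"
    proof -
      have "f x \<in> \<Union>(range ?T)" for x
      proof -
        obtain n :: nat where "norm x < n" using reals_Archimedean2 by blast
        then have "f x \<in> ?T n" using closure_subset[of "f ` ball 0 (real n)"] by auto
        then show ?thesis by blast
      qed
      then show ?thesis by auto
    qed
    moreover have "?X interior_of range f = range f"
      using interior_of_topspace[of ?X] by simp
    ultimately show False by simp
  qed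
  then obtain n y0 where "y0 \<in> ?X interior_of ?T n" by blast
  then obtain U where U: "openin ?X U" "y0 \<in> U" "U \<subseteq> ?T n" by (auto simp: interior_of_def)
  obtain r where r: "r > 0" "ball y0 r \<inter> range f \<subseteq> U"
    using U(1,2) unfolding openin_contains_ball by blast
  have y0: "y0 \<in> range f" using U by auto
  \<comment> \<open>The rescaled difference \<open>a - b\<close> below has norm at most 4 n / r
    times the norm of \<open>y\<close>; the summand 1 keeps \<open>c\<close> positive even for n =
    0.\<close>
  define c where "c = 4 * real n / r + 1"
  have app: "\<exists>a. norm a < n \<and> norm (z - f a) < r / 8" if "z \<in> range f" "norm (z - y0) < r" for z
  proof -
    have "z \<in> ball y0 r \<inter> range f" using that by (simp add: dist_norm norm_minus_commute)
    then have "z \<in> closure (f ` ball 0 (real n))" using r(2) U(3) by blast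
    moreover have "r / 8 > 0" using r(1) by simp
    ultimately obtain w where "w \<in> f ` ball 0 (real n)" "dist w z < r / 8"
      unfolding closure_approachable by blast
    then show ?thesis by (auto simp: dist_norm norm_minus_commute)
  qed
  show ?thesis
  proof (rule that)
    show "c > 0" using r(1) by (simp add: c_def add_nonneg_pos)
    fix y assume y: "y \<in> range f"
    show "\<exists>x. norm x \<le> c * norm y \<and> norm (y - f x) \<le> norm y / 2"
    proof (cases "y = 0")
      case True
      then show ?thesis by (intro exI[of _ 0]) (simp add: linear_0[OF lin])
    next
      case False
      \<comment> \<open>Scaling \<open>y\<close> to norm r / 2 keeps
        \<open>t *\<^sub>R y + y0\<close> inside the ball. Two errors of r / 8 add up to r / 4,
        which is half of that norm.\<close>
      define t where "t = r / (2 * norm y)"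
      have t: "t > 0" using False r(1) by (simp add: t_def)
      have nz: "norm (t *\<^sub>R y) = r / 2" using r(1) False by (simp add: t_def)
      have "t *\<^sub>R y + y0 \<in> range f" using sub y y0 by (intro subspace_add subspace_scale)
      moreover have "norm ((t *\<^sub>R y + y0) - y0) < r" using nz r(1) by simp
      ultimately obtain a where a: "norm a < n" "norm ((t *\<^sub>R y + y0) - f a) < r / 8"
        using app by blast
      obtain b where b: "norm b < n" "norm (y0 - f b) < r / 8" using app[OF y0] r(1) by auto
      have "norm (t *\<^sub>R y - f (a - b)) = norm (((t *\<^sub>R y + y0) - f a) - (y0 - f b))"
        by (simp add: linear_diff[OF lin] algebra_simps)
      also have "\<dots> \<le> r / 4" using norm_triangle_ineq4[of "(t *\<^sub>R y + y0) - f a" "y0 - f b"] a(2) b(2) by linarith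
      finally have le: "norm (t *\<^sub>R y - f (a - b)) \<le> r / 4" .
      let ?x = "(1 / t) *\<^sub>R (a - b)"
      have "y - f ?x = (1 / t) *\<^sub>R (t *\<^sub>R y - f (a - b))"
        using t linear_scale[OF lin, of "1 / t" "a - b"] by (simp add: scaleR_diff_right)
      then have "norm (y - f ?x) = (1 / t) * norm (t *\<^sub>R y - f (a - b))" using t by simp
      also have "\<dots> \<le> (1 / t) * (r / 4)" using t le by (intro mult_left_mono) auto
      also have "\<dots> = norm y / 2" using r(1) False by (simp add: t_def)
      finally have 1: "norm (y - f ?x) \<le> norm y / 2" .
      have "norm (a - b) \<le> 2 * n" using norm_triangle_ineq4[of a b] a(1) b(1) by linarith
      then have "norm ?x \<le> (1 / t) * (2 * n)" using t by (simp add: divide_right_mono)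
      also have "\<dots> = 4 * n / r * norm y" using r(1) False by (simp add: t_def)
      also have "\<dots> \<le> c * norm y" unfolding c_def by (rule mult_right_mono) auto
      finally show ?thesis using 1 by blast
    qed
  qed
qed

text \<open>Approximate preimages are iterated: each residual is again in the range and has at most
  half the norm, so the corrections are dominated by a geometric series and sum to an exact preimage
  by completeness of the domain.\<close>

lemma bounded_linear_closed_range_bounded_preimage:
  fixes f :: "'a::{real_normed_vector, complete_space} \<Rightarrow> 'b::{real_normed_vector, complete_space}"
  assumes f: "bounded_linear f" and R: "closed (range f)"
  obtains C where "C > 0" "\<And>y. y \<in> range f \<Longrightarrow> \<exists>x. f x = y \<and> norm x \<le> C * norm y"
proof -
  have lin: "linear f" using f bounded_linear.linear by blast
  have sub: "subspace (range f)" using linear_subspace_image[OF lin subspace_UNIV] .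
  obtain c where c: "c > 0"
    "\<And>y. y \<in> range f \<Longrightarrow> \<exists>x. norm x \<le> c * norm y \<and> norm (y - f x) \<le> norm y / 2"
    using bounded_linear_closed_range_approx_preimage[OF f R] by blast
  then obtain g where g: "\<And>y. y \<in> range f \<Longrightarrow> norm (g y) \<le> c * norm y"
    "\<And>y. y \<in> range f \<Longrightarrow> norm (y - f (g y)) \<le> norm y / 2" by metis
  have "\<exists>x. f x = y \<and> norm x \<le> 2 * c * norm y" if y: "y \<in> range f" for y
  proof -
    define z where "z k = ((\<lambda>w. w - f (g w)) ^^ k) y" for k
    have z0: "z 0 = y" and zS: "z (Suc k) = z k - f (g (z k))" for k by (simp_all add: z_def)
    have zR: "z k \<in> range f" for k
      by (induction k) (auto simp: z0 zS y intro!: subspace_diff[OF sub])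
    have zn: "norm (z k) \<le> norm y / 2 ^ k" for k
    proof (induction k)
      case (Suc k)
      show ?case using g(2)[OF zR[of k]] Suc by (simp add: zS)
    qed (simp add: z0)
    define s where "s k = (\<Sum>j<k. g (z j))" for k
    have fs: "f (s k) = y - z k" for k
      by (induction k) (auto simp: s_def linear_0[OF lin] linear_add[OF lin] z0 zS)
    let ?D = "c * norm y"
    have step: "norm (g (z k)) \<le> ?D / 2 ^ k" for k
      using order_trans[OF g(1)[OF zR[of k]] mult_left_mono[OF zn[of k], of c]] c(1) by simp
    \<comment> \<open>The geometric sum is kept in telescoped form, with its subtracted tail, so
      that the induction on k closes.\<close>
    have sd: "norm (s (m + k) - s m) \<le> 2 * ?D / 2 ^ m - 2 * ?D / 2 ^ (m + k)" for m k
    proof (induction k)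
      case (Suc k)
      have "s (m + Suc k) - s m = (s (m + k) - s m) + g (z (m + k))" by (simp add: s_def)
      then have "norm (s (m + Suc k) - s m) \<le> norm (s (m + k) - s m) + norm (g (z (m + k)))"
        using norm_triangle_ineq by metis
      also have "\<dots> \<le> (2 * ?D / 2 ^ m - 2 * ?D / 2 ^ (m + k)) + ?D / 2 ^ (m + k)"
        using Suc step[of "m + k"] by linarith
      also have "\<dots> = 2 * ?D / 2 ^ m - 2 * ?D / 2 ^ (m + Suc k)" by simp
      finally show ?case .
    qed simp
    have D0: "?D \<ge> 0" using c(1) by simp
    have sd': "norm (s n - s m) \<le> 2 * ?D / 2 ^ m" if "m \<le> n" for m n
    proof -
      have "2 * ?D / 2 ^ n \<ge> 0" using D0 by simp
      then show ?thesis using sd[of m "n - m"] that by simp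
    qed
    have "Cauchy s"
    proof (rule metric_CauchyI)
      fix e :: real assume e: "e > 0"
      have "(\<lambda>m. 2 * ?D * (1 / 2) ^ m) \<longlonglongrightarrow> 2 * ?D * 0"
        by (intro tendsto_intros LIMSEQ_power_zero) simp
      then have "eventually (\<lambda>m. 2 * ?D * (1 / 2) ^ m < e) sequentially"
        using order_tendstoD(2)[of _ _ _ e] e by simp
      then obtain M where "2 * ?D * (1 / 2) ^ M < e" by (auto simp: eventually_sequentially)
      then have M: "2 * ?D / 2 ^ M < e" by (simp add: power_one_over)
      have "dist (s m) (s n) < e" if "M \<le> m" "m \<le> n" for m n
      proof -
        have "2 * ?D / 2 ^ m \<le> 2 * ?D / 2 ^ M"
          using D0 that by (intro divide_left_mono power_increasing) auto
        then show ?thesis using sd'[OF that(2)] M by (simp add: dist_norm norm_minus_commute)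
      qed
      then show "\<exists>M. \<forall>m\<ge>M. \<forall>n\<ge>M. dist (s m) (s n) < e"
        by (intro exI[of _ M] allI impI) (metis dist_commute linear)
    qed
    then obtain x where x: "s \<longlonglongrightarrow> x" using Cauchy_convergent convergent_def by blast
    have "(\<lambda>k. f (s k)) \<longlonglongrightarrow> f x" using bounded_linear.tendsto[OF f x] .
    moreover have "(\<lambda>k. y - z k) \<longlonglongrightarrow> y - 0"
    proof (intro tendsto_intros, rule Lim_null_comparison)
      show "\<forall>\<^sub>F k in sequentially. norm (z k) \<le> norm y * (1 / 2) ^ k"
        using zn by (simp add: power_one_over)
      show "(\<lambda>k. norm y * (1 / 2) ^ k) \<longlonglongrightarrow> 0"
        using tendsto_mult_right_zero[OF LIMSEQ_power_zero[of "1/2::real"]] by simp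
    qed
    ultimately have "f x = y" unfolding fs using LIMSEQ_unique[of "\<lambda>k. y - z k" "f x" "y - 0"] by simp
    moreover have "norm x \<le> 2 * c * norm y"
    proof (rule LIMSEQ_le_const2[OF tendsto_norm[OF x]], intro exI allI impI)
      show "norm (s n) \<le> 2 * c * norm y" for n using sd'[of 0 n] by (simp add: s_def)
    qed
    ultimately show ?thesis by blast
  qed
  then show ?thesis using that[of "2 * c"] c(1) by simp
qed

subsection \<open>Invertible operators\<close>

text \<open>The bounded preimage result applies with the whole space as range, and injectivity
  identifies the bounded preimage with \<open>inv V y\<close>.\<close>

lemma bounded_clinear_inv:
  fixes V :: "'a::{complex_inner_space, complete_space} \<Rightarrow> 'a"
  assumes V: "bounded_clinear V" "bij V"
  shows "bounded_clinear (inv V)"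
proof -
  have s: "V (inv V x) = x" for x using V(2) by (simp add: bij_is_surj surj_f_inv_f)
  have i: "inv V (V x) = x" for x using V(2) by (simp add: bij_is_inj)
  obtain C where C: "\<And>y. y \<in> range V \<Longrightarrow> \<exists>x. V x = y \<and> norm x \<le> C * norm y"
    using bounded_linear_closed_range_bounded_preimage[OF bounded_clinear_bounded_linear[OF V(1)]] V(2)
    by (metis bij_is_surj closed_UNIV)
  show ?thesis
  proof (rule bounded_clinear_intro)
    show "inv V (x + y) = inv V x + inv V y" for x y
      by (metis V(1) bounded_clinear_add_apply i s)
    show "inv V (scaleC c x) = scaleC c (inv V x)" for c x
      by (metis V(1) bounded_clinear_scaleC i s)
    show "norm (inv V y) \<le> C * norm y" for y
      using C[of y] i s by (metis rangeI)
  qed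
qed

text \<open>Solving \<open>x + G x = y\<close> means finding the fixed point of the contraction that
  sends x to \<open>y - G x\<close>; Banach's theorem gives existence and uniqueness at
  once.\<close>

lemma bij_id_plus_contraction:
  fixes G :: "'a::{complex_inner_space, complete_space} \<Rightarrow> 'a"
  assumes G: "bounded_clinear G" and q: "0 \<le> q" "q < 1" "\<And>x. norm (G x) \<le> q * norm x"
  shows "bij (\<lambda>x. x + G x)"
proof -
  have "\<exists>!x. x + G x = y" for y
  proof -
    have "\<exists>!x. y - G x = x"
    proof (rule banach_fix_type[OF q(1,2)], intro allI)
      fix u v
      have "dist (y - G u) (y - G v) = norm (G (v - u))"
        by (simp add: dist_norm bounded_clinear_diff_apply[OF G])
      then show "dist (y - G u) (y - G v) \<le> q * dist u v"
        using q(3)[of "v - u"] by (simp add: dist_norm norm_minus_commute)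
    qed
    moreover have "y - G x = x \<longleftrightarrow> x + G x = y" for x by (auto simp: algebra_simps)
    ultimately show ?thesis by simp
  qed
  then show ?thesis by (simp add: bij_iff)
qed

lemma bij_small_perturbation:
  fixes V :: "'a::{complex_inner_space, complete_space} \<Rightarrow> 'a"
  assumes V: "bounded_clinear V" "bij V"
  obtains d where "d > 0" "\<And>B. bounded_clinear B \<Longrightarrow> (\<And>x. norm (B x) \<le> d * norm x) \<Longrightarrow> bij (\<lambda>x. V x + B x)"
proof -
  obtain K where K: "K > 0" "\<And>x. norm (inv V x) \<le> K * norm x"
    using bounded_clinear_bound[OF bounded_clinear_inv[OF V]] by blast
  show ?thesis
  \<comment> \<open>Factor V + B as V composed with I + W B, where W is the inverse of V. With this
    radius W B has norm at most 1/2.\<close>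
  proof (rule that[of "1 / (2 * K)"])
    show "1 / (2 * K) > 0" using K(1) by simp
    fix B :: "'a \<Rightarrow> 'a" assume B: "bounded_clinear B" "\<And>x. norm (B x) \<le> 1 / (2 * K) * norm x"
    have "bij (\<lambda>x. x + inv V (B x))"
    proof (rule bij_id_plus_contraction[where q = "1/2"])
      show "bounded_clinear (\<lambda>x. inv V (B x))"
        by (rule bounded_clinear_compose[OF bounded_clinear_inv[OF V] B(1)])
      fix x
      have "norm (inv V (B x)) \<le> K * norm (B x)" by (rule K(2))
      also have "\<dots> \<le> K * (1 / (2 * K) * norm x)" using K(1) B(2) by (intro mult_left_mono) auto
      finally show "norm (inv V (B x)) \<le> 1/2 * norm x" using K(1) by simp
    qed auto
    then have "bij (V \<circ> (\<lambda>x. x + inv V (B x)))" using V(2) by (rule bij_comp)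
    moreover have "V \<circ> (\<lambda>x. x + inv V (B x)) = (\<lambda>x. V x + B x)"
      using V by (auto simp: fun_eq_iff bounded_clinear_add_apply surj_f_inv_f bij_is_surj)
    ultimately show "bij (\<lambda>x. V x + B x)" by simp
  qed
qed

subsection \<open>Finite-rank and compact operators\<close>

definition finite_rank :: "('a::complex_inner_space \<Rightarrow> 'a) \<Rightarrow> bool" where
  "finite_rank F \<longleftrightarrow> bounded_clinear F \<and> fin_dim (range F)"

text \<open>Norm limits of finite-rank operators stand in for compact operators: the ideal
  properties follow from plain estimates, and a finite-rank piece can be split off with an
  arbitrarily small remainder. \<open>compact_op_approximable\<close> makes the link to
  \<open>compact_op\<close>.\<close>

definition approximable :: "('a::complex_inner_space \<Rightarrow> 'a) \<Rightarrow> bool" where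
  "approximable K \<longleftrightarrow> bounded_clinear K \<and>
     (\<forall>e>0. \<exists>F. finite_rank F \<and> (\<forall>x. norm (K x - F x) \<le> e * norm x))"

lemma finite_rank_add:
  assumes "finite_rank F" "finite_rank G" shows "finite_rank (\<lambda>x. F x + G x)"
proof -
  obtain A B where AB: "finite A" "range F \<subseteq> span A" "finite B" "range G \<subseteq> span B"
    using assms by (auto simp: finite_rank_def fin_dim_def)
  have "F x + G x \<in> span (A \<union> B)" for x
    using AB span_mono[of A "A \<union> B"] span_mono[of B "A \<union> B"] by (intro span_add) auto
  then have "fin_dim (range (\<lambda>x. F x + G x))"
    unfolding fin_dim_def by (intro exI[of _ "A \<union> B"]) (use AB in auto)
  then show ?thesis using assms by (simp add: finite_rank_def bounded_clinear_add)
qed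

lemma finite_rank_compose_left:
  assumes "bounded_clinear G" "finite_rank F" shows "finite_rank (\<lambda>x. G (F x))"
proof -
  have "range (\<lambda>x. G (F x)) = G ` range F" by auto
  then show ?thesis
    using assms fin_dim_linear_image[OF bounded_clinear_linear, of G "range F"]
    by (simp add: finite_rank_def bounded_clinear_compose)
qed

lemma finite_rank_compose_right:
  assumes "finite_rank F" "bounded_clinear G" shows "finite_rank (\<lambda>x. F (G x))"
  using assms fin_dim_subset[of "range F" "range (\<lambda>x. F (G x))"]
  by (auto simp: finite_rank_def bounded_clinear_compose)

lemma finite_rank_orth_proj:
  assumes "finite E" shows "finite_rank (orth_proj E)"
proof -
  have "fin_dim (range (orth_proj E))"
    unfolding fin_dim_def
    by (intro exI[of _ "E \<union> scaleC \<i> ` E"]) (use assms orth_proj_mem_span in auto)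
  then show ?thesis by (simp add: finite_rank_def bounded_clinear_orth_proj)
qed

lemma finite_rank_approximable:
  assumes "finite_rank F" shows "approximable F"
  unfolding approximable_def
proof (intro conjI allI impI)
  show "\<exists>G. finite_rank G \<and> (\<forall>x. norm (F x - G x) \<le> e * norm x)" if "e > 0" for e
    using assms that by (intro exI[of _ F]) simp
qed (use assms in \<open>simp add: finite_rank_def\<close>)

lemma approximable_bounded_clinear: "approximable K \<Longrightarrow> bounded_clinear K"
  by (simp add: approximable_def)

lemma approximable_add:
  assumes "approximable K" "approximable L" shows "approximable (\<lambda>x. K x + L x)"
  unfolding approximable_def
proof (intro conjI allI impI)
  fix e :: real assume "e > 0"
  then have e: "e / 2 > 0" by simp
  obtain F where F: "finite_rank F" "\<And>x. norm (K x - F x) \<le> e / 2 * norm x"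
    using assms(1) e unfolding approximable_def by meson
  obtain G where G: "finite_rank G" "\<And>x. norm (L x - G x) \<le> e / 2 * norm x"
    using assms(2) e unfolding approximable_def by meson
  have "norm ((K x + L x) - (F x + G x)) \<le> e * norm x" for x
    using norm_diff_triangle_ineq[of "K x" "L x" "F x" "G x"] F(2)[of x] G(2)[of x] by simp
  then show "\<exists>F. finite_rank F \<and> (\<forall>x. norm (K x + L x - F x) \<le> e * norm x)"
    using finite_rank_add[OF F(1) G(1)] by blast
qed (use assms in \<open>simp add: approximable_def bounded_clinear_add\<close>)

lemma approximable_compose_left:
  assumes "bounded_clinear G" "approximable K" shows "approximable (\<lambda>x. G (K x))"
  unfolding approximable_def
proof (intro conjI allI impI)
  fix e :: real assume e: "e > 0"
  obtain M where M: "M > 0" "\<And>x. norm (G x) \<le> M * norm x"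
    using bounded_clinear_bound[OF assms(1)] by blast
  have "e / M > 0" using e M(1) by simp
  then obtain F where F: "finite_rank F" "\<And>x. norm (K x - F x) \<le> e / M * norm x"
    using assms(2) unfolding approximable_def by meson
  have "norm (G (K x) - G (F x)) \<le> e * norm x" for x
  proof -
    have "norm (G (K x) - G (F x)) \<le> M * norm (K x - F x)"
      using M(2)[of "K x - F x"] by (simp add: bounded_clinear_diff_apply[OF assms(1)])
    also have "\<dots> \<le> M * (e / M * norm x)" using M(1) F(2) by (intro mult_left_mono) auto
    finally show ?thesis using M(1) by simp
  qed
  then show "\<exists>F. finite_rank F \<and> (\<forall>x. norm (G (K x) - F x) \<le> e * norm x)"
    using finite_rank_compose_left[OF assms(1) F(1)] by blast
qed (use assms in \<open>simp add: approximable_def bounded_clinear_compose\<close>)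

lemma approximable_compose_right:
  assumes "approximable K" "bounded_clinear G" shows "approximable (\<lambda>x. K (G x))"
  unfolding approximable_def
proof (intro conjI allI impI)
  fix e :: real assume e: "e > 0"
  obtain M where M: "M > 0" "\<And>x. norm (G x) \<le> M * norm x"
    using bounded_clinear_bound[OF assms(2)] by blast
  have "e / M > 0" using e M(1) by simp
  then obtain F where F: "finite_rank F" "\<And>x. norm (K x - F x) \<le> e / M * norm x"
    using assms(1) unfolding approximable_def by meson
  have "norm (K (G x) - F (G x)) \<le> e * norm x" for x
  proof -
    have "norm (K (G x) - F (G x)) \<le> e / M * norm (G x)" by (rule F(2))
    also have "\<dots> \<le> e / M * (M * norm x)" using M e by (intro mult_left_mono) auto
    finally show ?thesis using M(1) by simp
  qed
  then show "\<exists>F. finite_rank F \<and> (\<forall>x. norm (K (G x) - F x) \<le> e * norm x)"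
    using finite_rank_compose_right[OF F(1) assms(2)] by blast
qed (use assms in \<open>simp add: approximable_def bounded_clinear_compose\<close>)

lemma approximable_diff:
  assumes "approximable K" "approximable L" shows "approximable (\<lambda>x. K x - L x)"
proof -
  have "approximable (\<lambda>x. scaleC (- 1) (L x))"
    by (rule approximable_compose_left[OF bounded_clinear_const_scaleC[OF bounded_clinear_ident] assms(2)])
  from approximable_add[OF assms(1) this] show ?thesis by (simp add: scaleC_minus_left scaleC_one)
qed

lemma csubspace_span_cpx: "csubspace (span (D \<union> scaleC \<i> ` D))"
proof -
  let ?S = "span (D \<union> scaleC \<i> ` D)"
  have lin: "linear (scaleC \<i> :: 'a \<Rightarrow> 'a)"
    by (rule linearI) (simp_all add: scaleC_add_right scaleC_scaleR)
  have "scaleC \<i> ` ?S = span (scaleC \<i> ` (D \<union> scaleC \<i> ` D))"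
    using linear_span_image[OF lin] by metis
  also have "\<dots> \<subseteq> ?S"
  proof (rule span_minimal[OF _ subspace_span])
    have "scaleC \<i> (scaleC \<i> d) \<in> ?S" if "d \<in> D" for d
      using that by (simp add: scaleC_scaleC scaleC_minus_left scaleC_one span_neg span_base)
    then show "scaleC \<i> ` (D \<union> scaleC \<i> ` D) \<subseteq> ?S" by (auto intro: span_base)
  qed
  finally have i: "scaleC \<i> x \<in> ?S" if "x \<in> ?S" for x using that by blast
  have "scaleC c x \<in> ?S" if "x \<in> ?S" for c x
    using scaleC_Complex[of "Re c" "Im c" x] i[OF that] that by (simp add: span_add span_scale)
  then show ?thesis by (simp add: csubspace_def)
qed

text \<open>A finite e/2-net of the image of the unit ball spans a finite-dimensional complex
  subspace. Projecting onto it approximates every image point at least as well as the nearest net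
  point does.\<close>

lemma compact_op_approximable:
  assumes K: "compact_op K" shows "approximable K"
  unfolding approximable_def
proof (intro conjI allI impI)
  have cl: "bounded_clinear K" and cp: "compact (closure (K ` ball 0 1))"
    using K by (auto simp: compact_op_def)
  then show "bounded_clinear K" by simp
  fix e :: real assume e: "e > 0"
  then have "e / 2 > 0" by simp
  then obtain D where D: "finite D" "closure (K ` ball 0 1) \<subseteq> (\<Union>x\<in>D. ball x (e / 2))"
    using conjunct2[OF cp[unfolded compact_eq_totally_bounded], rule_format, of "e / 2"] by auto
  have "fin_dim (span (D \<union> scaleC \<i> ` D))" 
    unfolding fin_dim_def using D(1) by (intro exI[of _ "D \<union> scaleC \<i> ` D"]) simp
  then obtain E where E: "finite E" "orthonormal E"
    "\<And>x. x \<in> span (D \<union> scaleC \<i> ` D) \<Longrightarrow> orth_proj E x = x"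
    using orthonormal_basis_exists[OF csubspace_span_cpx] by metis
  have unit: "norm (K x - orth_proj E (K x)) \<le> e / 2" if "norm x < 1" for x
  proof -
    have "K x \<in> closure (K ` ball 0 1)" using that closure_subset by fastforce
    then obtain d where d: "d \<in> D" "dist d (K x) < e / 2" using D(2) by auto
    have "orth_proj E d = d" using d(1) by (intro E(3) span_base) simp
    then show ?thesis
      using norm_diff_orth_proj_le[OF E(2,1), of d "K x"] d(2) by (simp add: dist_norm norm_minus_commute)
  qed
  let ?L = "\<lambda>x. K x - orth_proj E (K x)"
  have L: "bounded_clinear ?L"
    by (intro bounded_clinear_diff cl bounded_clinear_compose[OF bounded_clinear_orth_proj cl])
  have "norm (?L x) \<le> e * norm x" for x
  proof (cases "x = 0")
    case True
    then show ?thesis by (simp add: bounded_clinear_zero_apply[OF L])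
  next
    case False
    \<comment> \<open>The unit ball is open, so x is scaled to norm 1/2; this turns the bound e / 2
      on the ball into the factor e.\<close>
    let ?t = "1 / (2 * norm x)"
    have "norm (?L (?t *\<^sub>R x)) \<le> e / 2" by (rule unit) (use False in simp)
    moreover have "?L (?t *\<^sub>R x) = ?t *\<^sub>R ?L x"
      by (rule linear_scale[OF bounded_clinear_linear[OF L]])
    ultimately have "?t * norm (?L x) \<le> e / 2" by (simp only: norm_scaleR) simp
    then show ?thesis using False by (simp add: field_simps)
  qed
  then show "\<exists>F. finite_rank F \<and> (\<forall>x. norm (K x - F x) \<le> e * norm x)"
    using finite_rank_compose_right[OF finite_rank_orth_proj[OF E(1)] cl] by blast
qed

section \<open>Compactness of sums and of finite-rank operators\<close>

lemma compact_op_zero: "compact_op (\<lambda>x. 0)"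
  by (simp add: compact_op_def bounded_clinear_zero image_constant_conv)

lemma compact_closure_subset:
  fixes C :: "'a::t2_space set"
  assumes "compact C" "S \<subseteq> C" shows "compact (closure S)"
proof -
  have "closure S \<subseteq> C" using assms by (intro closure_minimal compact_imp_closed)
  then have "C \<inter> closure S = closure S" by (rule Int_absorb1)
  with compact_Int_closed[OF assms(1) closed_closure[of S]] show ?thesis by simp
qed

lemma compact_op_add:
  assumes "compact_op K" "compact_op L" shows "compact_op (\<lambda>x. K x + L x)"
proof -
  let ?A = "closure (K ` ball 0 1)" and ?B = "closure (L ` ball 0 1)"
  have c: "compact {x + y | x y. x \<in> ?A \<and> y \<in> ?B}"
    using assms by (intro compact_sums) (auto simp: compact_op_def)
  have "(\<lambda>x. K x + L x) ` ball 0 1 \<subseteq> {x + y | x y. x \<in> ?A \<and> y \<in> ?B}"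
    using closure_subset[of "K ` ball 0 1"] closure_subset[of "L ` ball 0 1"] by blast
  then have "compact (closure ((\<lambda>x. K x + L x) ` ball 0 1))" by (rule compact_closure_subset[OF c])
  then show ?thesis using assms by (simp add: compact_op_def bounded_clinear_add)
qed

lemma compact_op_rank_one:
  assumes "bounded_clinear f" shows "compact_op (\<lambda>x. scaleC (cinner a (f x)) b)"
proof -
  obtain M where M: "M > 0" "\<And>x. norm (f x) \<le> M * norm x"
    using bounded_clinear_bound[OF assms(1)] by blast
  let ?C = "(\<lambda>c. scaleC c b) ` cball 0 (norm a * M)"
  have c: "compact ?C"
    by (intro compact_continuous_image linear_continuous_on bounded_linear_scaleC_left) simp
  have "(\<lambda>x. scaleC (cinner a (f x)) b) ` ball 0 1 \<subseteq> ?C"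
  proof safe
    fix x :: 'a assume "x \<in> ball 0 1"
    then have "M * norm x \<le> M * 1" using M(1) by (intro mult_left_mono) auto
    then have "norm (f x) \<le> M" using M(2)[of x] by simp
    then have "cmod (cinner a (f x)) \<le> norm a * M"
      by (intro order_trans[OF Cauchy_Schwarz_cinner] mult_left_mono) auto
    then show "scaleC (cinner a (f x)) b \<in> ?C" by simp
  qed
  then have "compact (closure ((\<lambda>x. scaleC (cinner a (f x)) b) ` ball 0 1))"
    by (rule compact_closure_subset[OF c])
  then show ?thesis using assms by (simp add: compact_op_def bounded_clinear_rank_one)
qed

text \<open>An orthonormal basis of the range writes \<open>F\<close> as a finite sum of rank-one
  operators, each of which maps the unit ball into the image of a compact disc of scalars.\<close>

lemma finite_rank_compact_op:
  assumes "finite_rank F" shows "compact_op F"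
proof -
  have F: "bounded_clinear F" "fin_dim (range F)" using assms by (auto simp: finite_rank_def)
  obtain E where E: "finite E" "\<And>x. x \<in> range F \<Longrightarrow> orth_proj E x = x"
    using orthonormal_basis_exists[OF csubspace_range[OF F(1)] F(2)] by metis
  have "compact_op (\<lambda>x. \<Sum>e\<in>E. scaleC (cinner e (F x)) e)"
    using E(1) by (induction E rule: finite_induct)
      (simp_all add: compact_op_zero compact_op_add compact_op_rank_one F(1))
  moreover have "F = (\<lambda>x. \<Sum>e\<in>E. scaleC (cinner e (F x)) e)"
    using E(2) by (simp add: fun_eq_iff orth_proj_def)
  ultimately show ?thesis by metis
qed

subsection \<open>Weyl operators as compact perturbations of invertible operators\<close>

lemma fin_dim_inj_image:
  assumes f: "linear f" "inj_on f X" and X: "subspace X" "fin_dim (f ` X)"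
  shows "fin_dim X"
proof -
  obtain D where D: "finite D" "f ` X \<subseteq> span D" using X(2) by (auto simp: fin_dim_def)
  obtain B where B: "B \<subseteq> X" "independent B" "X \<subseteq> span B" "card B = dim X" by (rule basis_exists)
  have "span B \<subseteq> X" by (rule span_minimal[OF B(1) X(1)])
  then have "inj_on f (span B)" by (rule inj_on_subset[OF f(2)])
  then have "independent (f ` B)" by (rule linear_independent_injective_image[OF f(1) B(2)])
  moreover have "f ` B \<subseteq> span D" using D(2) B(1) by auto
  ultimately have "finite (f ` B)" using independent_span_bound[OF D(1)] by simp
  then have "finite B" using finite_imageD inj_on_subset[OF f(2) B(1)] by metis
  then show ?thesis unfolding fin_dim_def using B(3) by (intro exI[of _ B]) simp
qed

text \<open>All dimensions are compared inside finite-dimensional spaces. With A = V + F, S = range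
  F, R = range A and U the preimage of S under V, the map A sends U onto the intersection of R and S
  with kernel ker A, while projection onto the complement of R sends S onto that complement with
  kernel the same intersection. Since V identifies U with S, rank-nullity makes ker A and the
  complement of R equal in dimension.\<close>

lemma bij_plus_finite_rank_fredholm:
  fixes V F :: "'a::{complex_inner_space, complete_space} \<Rightarrow> 'a"
  assumes V: "bounded_clinear V" "bij V" and F: "finite_rank F"
  shows "fredholm (\<lambda>x. V x + F x) \<and> fredholm_index (\<lambda>x. V x + F x) = 0"
proof -
  define A where "A x = V x + F x" for x
  define W where "W = inv V"
  define S where "S = range F"
  define U where "U = W ` S"
  define R where "R = range A"
  have VW: "V (W x) = x" and WV: "W (V x) = x" for x
    using V(2) by (simp_all add: W_def bij_is_surj bij_is_inj surj_f_inv_f)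
  have clF: "bounded_clinear F" and fdS: "fin_dim S" using F by (auto simp: finite_rank_def S_def)
  have clA: "bounded_clinear A" unfolding A_def by (rule bounded_clinear_add[OF V(1) clF])
  have clW: "bounded_clinear W" unfolding W_def by (rule bounded_clinear_inv[OF V])
  have csS: "csubspace S" unfolding S_def by (rule csubspace_range[OF clF])
  have csR: "csubspace R" unfolding R_def by (rule csubspace_range[OF clA])
  have sS: "subspace S" and sR: "subspace R" using csS csR by (auto simp: csubspace_def)
  have FS: "F x \<in> S" for x by (simp add: S_def)
  have AR: "A x \<in> R" for x by (simp add: R_def)
  have fdU: "fin_dim U" unfolding U_def
    by (rule fin_dim_linear_image[OF bounded_clinear_linear[OF clW] fdS])
  have sU: "subspace U" unfolding U_def
    by (rule linear_subspace_image[OF bounded_clinear_linear[OF clW] sS])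
  have U_iff: "x \<in> U \<longleftrightarrow> V x \<in> S" for x
    unfolding U_def using VW WV by (metis imageE imageI)
  have AS_iff: "A x \<in> S \<longleftrightarrow> x \<in> U" for x
  proof
    assume "A x \<in> S"
    then have "A x - F x \<in> S" using FS sS by (intro subspace_diff)
    then show "x \<in> U" by (simp add: A_def U_iff)
  next
    assume "x \<in> U"
    then show "A x \<in> S" unfolding A_def U_iff using FS sS by (intro subspace_add)
  qed
  have AU: "A ` U = R \<inter> S"
  proof (intro set_eqI iffI)
    show "y \<in> A ` U" if "y \<in> R \<inter> S" for y using that AS_iff by (auto simp: R_def)
  qed (use AS_iff AR in auto)
  have kerU: "{x \<in> U. A x = 0} = ker_op A"
  proof -
    have "x \<in> U" if "A x = 0" for x using AS_iff[of x] that subspace_0[OF sS] by simp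
    then show ?thesis by (auto simp: ker_op_def)
  qed
  have fdker: "fin_dim (ker_op A)" using fin_dim_subset[OF fdU] kerU by (metis Collect_subset)
  have decomp: "y = A (W y) - F (W y)" for y by (simp add: A_def VW)
  \<comment> \<open>Because y and \<open>- F (W y)\<close> differ by an element of R, membership in
    R is decided by a continuous finite-rank map. This exhibits R as the preimage of a
    finite-dimensional, hence closed, subspace.\<close>
  have R_iff: "y \<in> R \<longleftrightarrow> F (W y) \<in> R \<inter> S" for y
  proof
    assume "y \<in> R"
    then have "A (W y) - y \<in> R" using AR sR by (intro subspace_diff)
    moreover have "A (W y) - y = F (W y)" by (simp add: A_def VW)
    ultimately show "F (W y) \<in> R \<inter> S" using FS by simp
  next
    assume "F (W y) \<in> R \<inter> S"
    then have "A (W y) - F (W y) \<in> R" using AR sR by (intro subspace_diff) auto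
    then show "y \<in> R" using decomp[of y] by simp
  qed
  have csRS: "csubspace (R \<inter> S)"
    using csR csS by (auto simp: csubspace_def subspace_inter)
  have fdRS: "fin_dim (R \<inter> S)" using fin_dim_subset[OF fdS] by simp
  have clR: "closed R"
  proof -
    have "R = (\<lambda>y. F (W y)) -` (R \<inter> S)" using R_iff by auto
    moreover have "closed ((\<lambda>y. F (W y)) -` (R \<inter> S))"
      by (intro continuous_closed_vimage fin_dim_csubspace_closed[OF csRS fdRS]
          linear_continuous_at bounded_clinear_bounded_linear bounded_clinear_compose[OF clF clW])
    ultimately show ?thesis by simp
  qed
  have csO: "csubspace (orth_compl R)" by (rule csubspace_orth_compl)
  have sO: "subspace (orth_compl R)" using csO by (simp add: csubspace_def)
  have fdO: "fin_dim (orth_compl R)"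
  proof -
    obtain E where E: "finite E" "orthonormal E" "E \<subseteq> S" "\<And>x. x \<in> S \<Longrightarrow> orth_proj E x = x"
      using orthonormal_basis_exists[OF csS fdS] by metis
    have lin: "linear (orth_proj E)" by (rule bounded_clinear_linear[OF bounded_clinear_orth_proj])
    \<comment> \<open>If y is orthogonal to R and has zero projection on S, it is orthogonal to both
      \<open>A (W y)\<close> and \<open>F (W y)\<close>, hence to their difference, which is y
      itself.\<close>
    have "inj_on (orth_proj E) (orth_compl R)"
      unfolding linear_injective_on_subspace_0[OF lin sO]
    proof (intro ballI impI)
      fix y assume y: "y \<in> orth_compl R" "orth_proj E y = 0"
      have "cinner y (F (W y)) = cinner y (orth_proj E (F (W y)))" using E(4)[OF FS] by simp
      also have "\<dots> = (\<Sum>e\<in>E. cinner e (F (W y)) * cinner y e)"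
        by (simp add: orth_proj_def cinner_sum_right cinner_scaleC_right)
      also have "\<dots> = 0"
      proof (rule sum.neutral, rule ballI)
        fix e assume "e \<in> E"
        then have "cinner e y = 0" using cinner_orth_proj[OF E(2,1), of e y] y(2) by simp
        then have "cinner y e = 0" by (subst cinner_commute) simp
        then show "cinner e (F (W y)) * cinner y e = 0" by simp
      qed
      finally have 1: "cinner y (F (W y)) = 0" .
      have "cinner (A (W y)) y = 0" using y(1) AR by (auto simp: orth_compl_def)
      then have "cinner y (A (W y)) = 0" by (subst cinner_commute) simp
      with 1 have "cinner y (A (W y) - F (W y)) = 0" by (simp add: cinner_diff_right)
      then have "cinner y y = 0" using decomp[of y] by simp
      then show "y = 0" by (simp add: cinner_eq_zero_iff)
    qed
    moreover have "fin_dim (orth_proj E ` orth_compl R)"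
      using csubspace_mem_orth_proj[OF csS E(3)] by (intro fin_dim_subset[OF fdS]) auto
    ultimately show ?thesis using fin_dim_inj_image[OF lin _ sO] by blast
  qed
  \<comment> \<open>Rank-nullity for the projection onto the complement of R, restricted to S. It is
    onto because y in the complement is the projection of \<open>- F (W y)\<close>, the term
    \<open>A (W y)\<close> being killed.\<close>
  have "dim S = dim (orth_compl R) + dim (R \<inter> S)"
  proof -
    obtain E where E: "E \<subseteq> orth_compl R" "\<And>x. x \<in> orth_compl R \<Longrightarrow> orth_proj E x = x"
      using orthonormal_basis_exists[OF csO fdO] by metis
    have lin: "linear (orth_proj E)" by (rule bounded_clinear_linear[OF bounded_clinear_orth_proj])
    have "{x \<in> S. orth_proj E x = 0} = R \<inter> S"
    proof (intro set_eqI iffI)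
      fix x assume "x \<in> {x \<in> S. orth_proj E x = 0}"
      then show "x \<in> R \<inter> S" using diff_orth_proj_mem[OF clR csR E(2,1), of x] by simp
    qed (use orth_compl_orth_proj_zero[OF E(1)] in auto)
    moreover have "orth_proj E ` S = orth_compl R"
    proof (intro set_eqI iffI)
      fix y assume y: "y \<in> orth_compl R"
      have "y = orth_proj E (A (W y) - F (W y))" using E(2)[OF y] decomp[of y] by simp
      also have "\<dots> = orth_proj E (- F (W y))"
        using orth_compl_orth_proj_zero[OF E(1) AR] lin by (simp add: linear_diff linear_neg)
      finally show "y \<in> orth_proj E ` S" using subspace_neg[OF sS FS] by blast
    qed (use csubspace_mem_orth_proj[OF csO E(1)] in auto)
    ultimately show ?thesis using dim_image_plus_dim_kernel[OF lin sS fdS] by simp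
  qed
  moreover have "dim U = dim (R \<inter> S) + dim (ker_op A)"
    using dim_image_plus_dim_kernel[OF bounded_clinear_linear[OF clA] sU fdU] AU kerU by simp
  moreover have "dim U = dim S"
  proof -
    have "V ` U = S" unfolding U_def by (auto simp: VW image_image)
    moreover have "{x \<in> U. V x = 0} = {0}"
    proof (intro set_eqI iffI)
      fix x assume "x \<in> {x \<in> U. V x = 0}"
      then show "x \<in> {0}" using WV[of x] bounded_clinear_zero_apply[OF clW] by simp
    qed (use subspace_0[OF sU] bounded_clinear_zero_apply[OF V(1)] in auto)
    moreover have "dim {0::'a} = 0" using dim_le_card[of "{0::'a}" "{}"] by simp
    ultimately show ?thesis
      using dim_image_plus_dim_kernel[OF bounded_clinear_linear[OF V(1)] sU fdU] by simp
  qed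
  ultimately have "dim (ker_op A) = dim (orth_compl R)" by simp
  then have "fredholm A \<and> fredholm_index A = 0"
    using clA clR fdker fdO by (simp add: fredholm_def fredholm_index_def cdim_def R_def)
  moreover have "A = (\<lambda>x. V x + F x)" by (simp add: fun_eq_iff A_def)
  ultimately show ?thesis by simp
qed

text \<open>Index zero lets a bijection \<open>h\<close> match an orthonormal basis of the kernel
  with one of the complement of the range. The resulting finite-rank \<open>F\<close> carries the
  kernel onto that complement, and \<open>A - F\<close> is invertible.\<close>

lemma fredholm_index_zero_decomposition:
  fixes A :: "'a::{complex_inner_space, complete_space} \<Rightarrow> 'a"
  assumes A: "fredholm A" "fredholm_index A = 0"
  obtains V F where "bounded_clinear V" "bij V" "finite_rank F" "A = (\<lambda>x. V x + F x)"
proof -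
  have clA: "bounded_clinear A" and clR: "closed (range A)" and fdN: "fin_dim (ker_op A)"
    and fdO: "fin_dim (orth_compl (range A))" using A(1) by (auto simp: fredholm_def)
  have csN: "csubspace (ker_op A)" by (rule csubspace_ker_op[OF clA])
  have csO: "csubspace (orth_compl (range A))" by (rule csubspace_orth_compl)
  obtain E where E: "finite E" "orthonormal E" "E \<subseteq> ker_op A"
    "\<And>x. x \<in> ker_op A \<Longrightarrow> orth_proj E x = x" "dim (ker_op A) = 2 * card E"
    using orthonormal_basis_exists[OF csN fdN] by metis
  obtain D where D: "finite D" "orthonormal D" "D \<subseteq> orth_compl (range A)"
    "\<And>x. x \<in> orth_compl (range A) \<Longrightarrow> orth_proj D x = x" "dim (orth_compl (range A)) = 2 * card D"
    using orthonormal_basis_exists[OF csO fdO] by metis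
  \<comment> \<open>Both real dimensions are even, so no information is lost when
    \<open>cdim\<close> halves them.\<close>
  have "card E = card D" using A(2) E(5) D(5) by (simp add: fredholm_index_def cdim_def)
  then obtain h where h: "bij_betw h E D" using finite_same_card_bij E(1) D(1) by blast
  define F where "F x = (\<Sum>e\<in>E. scaleC (cinner e x) (h e))" for x
  define V where "V x = A x - F x" for x
  have clF: "bounded_clinear F" unfolding F_def
    by (intro bounded_clinear_sum bounded_clinear_rank_one[OF bounded_clinear_ident])
  have clV: "bounded_clinear V" unfolding V_def by (rule bounded_clinear_diff[OF clA clF])
  have hD: "h e \<in> D" if "e \<in> E" for e using h that by (auto simp: bij_betw_def)
  have FO: "F x \<in> orth_compl (range A)" for x
    unfolding F_def using csO hD D(3) unfolding csubspace_def
    by (intro subspace_sum) auto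
  have frF: "finite_rank F"
    unfolding finite_rank_def using clF FO by (intro conjI fin_dim_subset[OF fdO]) auto
  have hF: "cinner (h e) (F x) = cinner e x" if e: "e \<in> E" for e x
  proof -
    have "cinner (h e) (F x) = (\<Sum>f\<in>E. if f = e then cinner e x else 0)"
      unfolding F_def cinner_sum_right
    proof (rule sum.cong[OF refl])
      fix f assume f: "f \<in> E"
      have "h e = h f \<longleftrightarrow> e = f" using h e f by (auto simp: bij_betw_def inj_on_def)
      then show "cinner (h e) (scaleC (cinner f x) (h f)) = (if f = e then cinner e x else 0)"
        using D(2) hD[OF e] hD[OF f] by (auto simp: orthonormal_def cinner_scaleC_right)
    qed
    then show ?thesis using e E(1) by simp
  qed
  \<comment> \<open>Here A x and F x are equal and orthogonal, so both vanish; then x lies in the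
    kernel of A and has zero coefficients in its basis.\<close>
  have ker0: "x = 0" if x: "V x = 0" for x
  proof -
    have eq: "A x = F x" using x by (simp add: V_def)
    have "cinner (A x) (F x) = 0" using FO[of x] by (auto simp: orth_compl_def)
    then have z: "F x = 0" using eq by (simp add: cinner_eq_zero_iff)
    then have "x \<in> ker_op A" using eq by (simp add: ker_op_def)
    then have "x = orth_proj E x" using E(4) by simp
    also have "\<dots> = 0" using hF[of _ x] z by (simp add: orth_proj_def)
    finally show ?thesis .
  qed
  have "inj V"
  proof (rule injI)
    fix x y assume "V x = V y"
    then have "V (x - y) = 0" by (simp add: bounded_clinear_diff_apply[OF clV])
    then show "x = y" using ker0 by fastforce
  qed
  moreover have "surj V"
  proof -
    have "\<exists>x. V x = y" for y
    proof -
      define w where "w = orth_proj D y"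
      have wO: "w \<in> orth_compl (range A)"
        unfolding w_def by (rule csubspace_mem_orth_proj[OF csO D(3)])
      have "y - w \<in> range A"
        unfolding w_def by (rule diff_orth_proj_mem[OF clR csubspace_range[OF clA] D(4,3)])
      then obtain a where a: "A a = y - w" by auto
      define v where "v = (\<Sum>e\<in>E. scaleC (cinner (h e) w) e)"
      \<comment> \<open>The vector \<open>a\<close> solves the equation on the range. Dropping its
        kernel component makes F vanish on it, and \<open>v\<close> is chosen with F v = w, so F x =
        - w and V x = (y - w) + w.\<close>
      define x where "x = a - orth_proj E a - v"
      have kv: "v \<in> ker_op A"
        unfolding v_def using csN E(3) unfolding csubspace_def by (intro subspace_sum) auto
      have kp: "orth_proj E a \<in> ker_op A" by (rule csubspace_mem_orth_proj[OF csN E(3)])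
      have Ax: "A x = y - w"
        using kv kp a by (simp add: x_def bounded_clinear_diff_apply[OF clA] ker_op_def)
      have ev: "cinner e v = cinner (h e) w" if e: "e \<in> E" for e
      proof -
        have "cinner e v = (\<Sum>f\<in>E. if f = e then cinner (h e) w else 0)"
          unfolding v_def cinner_sum_right
          by (rule sum.cong) (use E(2) e in \<open>auto simp: orthonormal_def cinner_scaleC_right\<close>)
        then show ?thesis using e E(1) by simp
      qed
      have "F x = (\<Sum>e\<in>E. - scaleC (cinner (h e) w) (h e))"
        unfolding F_def
      proof (rule sum.cong[OF refl])
        fix e assume e: "e \<in> E"
        have "cinner e x = - cinner (h e) w"
          using cinner_orth_proj[OF E(2,1) e, of a] ev[OF e] by (simp add: x_def cinner_diff_right)
        then show "scaleC (cinner e x) (h e) = - scaleC (cinner (h e) w) (h e)"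
          by (simp add: scaleC_minus_left)
      qed
      also have "\<dots> = - orth_proj D w"
        unfolding orth_proj_def sum_negf using sum.reindex_bij_betw[OF h, of "\<lambda>d. scaleC (cinner d w) d"]
        by simp
      also have "\<dots> = - w" using D(4)[OF wO] by simp
      finally have "V x = y" using Ax by (simp add: V_def)
      then show ?thesis by blast
    qed
    then show ?thesis by (simp add: surj_def) metis
  qed
  ultimately have "bij V" by (simp add: bij_def)
  moreover have "A = (\<lambda>x. V x + F x)" by (simp add: fun_eq_iff V_def)
  ultimately show ?thesis using that[OF clV _ frF] by simp
qed

text \<open>This form of "Fredholm of index zero" makes stability under compact and under small
  perturbations immediate, without additivity or continuity of the index.\<close>

definition weyl_op :: "('a::complex_inner_space \<Rightarrow> 'a) \<Rightarrow> bool" where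
  "weyl_op A \<longleftrightarrow> (\<exists>V K. bounded_clinear V \<and> bij V \<and> approximable K \<and> A = (\<lambda>x. V x + K x))"

lemma weyl_opI:
  assumes "bounded_clinear V" "bij V" "approximable K" "\<And>x. A x = V x + K x"
  shows "weyl_op A"
  unfolding weyl_op_def using assms by (intro exI[of _ V] exI[of _ K]) auto

lemma weyl_opE:
  assumes "weyl_op A"
  obtains V K where "bounded_clinear V" "bij V" "approximable K" "\<forall>x. A x = V x + K x"
  using assms unfolding weyl_op_def by auto

lemma weyl_op_bounded_clinear: "weyl_op A \<Longrightarrow> bounded_clinear A"
  unfolding weyl_op_def by (auto intro: bounded_clinear_add approximable_bounded_clinear)

text \<open>For the forward direction, the approximable part is split into a finite-rank operator
  and a remainder small enough to be absorbed into the invertible part, which reduces to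
  \<open>bij_plus_finite_rank_fredholm\<close>.\<close>

lemma weyl_op_iff_fredholm_index_zero:
  fixes A :: "'a::{complex_inner_space, complete_space} \<Rightarrow> 'a"
  shows "weyl_op A \<longleftrightarrow> fredholm A \<and> fredholm_index A = 0"
proof
  assume "weyl_op A"
  then obtain V K where V: "bounded_clinear V" "bij V" and K: "approximable K"
    and A: "\<forall>x. A x = V x + K x" by (rule weyl_opE)
  obtain d where d: "d > 0"
    "\<And>B. bounded_clinear B \<Longrightarrow> (\<And>x. norm (B x) \<le> d * norm x) \<Longrightarrow> bij (\<lambda>x. V x + B x)"
    using bij_small_perturbation[OF V] by blast
  obtain F where F: "finite_rank F" "\<And>x. norm (K x - F x) \<le> d * norm x"
    using K d(1) unfolding approximable_def by meson
  have cl: "bounded_clinear (\<lambda>x. K x - F x)"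
    using K F(1) by (intro bounded_clinear_diff) (auto simp: approximable_def finite_rank_def)
  have "bij (\<lambda>x. V x + (K x - F x))" by (rule d(2)[OF cl F(2)])
  from bij_plus_finite_rank_fredholm[OF bounded_clinear_add[OF V(1) cl] this F(1)]
  have "fredholm (\<lambda>x. V x + K x) \<and> fredholm_index (\<lambda>x. V x + K x) = 0" by simp
  moreover have "A = (\<lambda>x. V x + K x)" using A by (simp add: fun_eq_iff)
  ultimately show "fredholm A \<and> fredholm_index A = 0" by simp
next
  assume "fredholm A \<and> fredholm_index A = 0"
  then show "weyl_op A"
    using fredholm_index_zero_decomposition[of A] finite_rank_approximable weyl_opI by metis
qed

section \<open>Stability of Weyl operators and their inverses in the Calkin algebra\<close>

lemma weyl_op_add_approximable:
  assumes "weyl_op A" "approximable L" shows "weyl_op (\<lambda>x. A x + L x)"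
proof -
  obtain V K where V: "bounded_clinear V" "bij V" "approximable K" "\<forall>x. A x = V x + K x"
    using assms(1) by (rule weyl_opE)
  show ?thesis by (rule weyl_opI[OF V(1,2) approximable_add[OF V(3) assms(2)]]) (simp add: V(4))
qed

lemma weyl_op_small_perturbation:
  fixes A :: "'a::{complex_inner_space, complete_space} \<Rightarrow> 'a"
  assumes "weyl_op A"
  obtains d where "d > 0"
    "\<And>B. bounded_clinear B \<Longrightarrow> (\<And>x. norm (B x) \<le> d * norm x) \<Longrightarrow> weyl_op (\<lambda>x. A x + B x)"
proof -
  obtain V K where V: "bounded_clinear V" "bij V" "approximable K" "\<forall>x. A x = V x + K x"
    using assms(1) by (rule weyl_opE)
  obtain d where d: "d > 0"
    "\<And>B. bounded_clinear B \<Longrightarrow> (\<And>x. norm (B x) \<le> d * norm x) \<Longrightarrow> bij (\<lambda>x. V x + B x)"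
    using bij_small_perturbation[OF V(1,2)] by blast
  show ?thesis
  proof (rule that[OF d(1)])
    fix B :: "'a \<Rightarrow> 'a" assume B: "bounded_clinear B" "\<And>x. norm (B x) \<le> d * norm x"
    show "weyl_op (\<lambda>x. A x + B x)"
      by (rule weyl_opI[OF bounded_clinear_add[OF V(1) B(1)] d(2)[OF B] V(3)]) (simp add: V(4))
  qed
qed

text \<open>Passing through the Fredholm characterisation gives a finite-rank second summand
  \<open>F\<close>. The inverse of \<open>V\<close> is then a Calkin inverse of \<open>A\<close>,
  with the two errors F composed with it on either side, and these are compact.\<close>

lemma weyl_op_calkin_inverse:
  fixes A :: "'a::{complex_inner_space, complete_space} \<Rightarrow> 'a"
  assumes "weyl_op A"
  obtains R where "calkin_inverse A R"
proof -
  obtain V F where V: "bounded_clinear V" "bij V" "finite_rank F" "A = (\<lambda>x. V x + F x)"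
    using assms fredholm_index_zero_decomposition unfolding weyl_op_iff_fredholm_index_zero by blast
  have inv: "V (inv V x) = x" "inv V (V x) = x" for x
    using V(2) by (simp_all add: bij_is_surj bij_is_inj surj_f_inv_f)
  have cl: "bounded_clinear (inv V)" by (rule bounded_clinear_inv[OF V(1,2)])
  have "compact_op (\<lambda>x. F (inv V x))" "compact_op (\<lambda>x. inv V (F x))"
    using finite_rank_compose_left[OF cl V(3)] finite_rank_compose_right[OF V(3) cl]
    by (auto intro: finite_rank_compact_op)
  then have "calkin_inverse A (inv V)"
    using cl by (simp add: calkin_inverse_def V(4) inv bounded_clinear_add_apply[OF cl])
  then show ?thesis by (rule that)
qed

text \<open>The Calkin-algebra Neumann series: with \<open>R'\<close> a representative of \<open>\<pi>(A)\<inverse>\<close> of norm below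
  \<open>1 / e\<close>, the operator \<open>A + B\<close> agrees with \<open>A (I + R' B)\<close> modulo compacts, and \<open>I + R' B\<close> is invertible.\<close>

lemma weyl_op_calkin_perturbation:
  fixes A :: "'a::{complex_inner_space, complete_space} \<Rightarrow> 'a"
  assumes A: "weyl_op A" and R: "calkin_inverse A R" "calkin_norm R < 1 / e" and e: "e > 0"
    and B: "bounded_clinear B" "\<And>x. norm (B x) \<le> e * norm x"
  shows "weyl_op (\<lambda>x. A x + B x)"
proof -
  obtain V L where V: "bounded_clinear V" "bij V" "approximable L" "\<forall>x. A x = V x + L x"
    using A by (rule weyl_opE)
  have clA: "bounded_clinear A" by (rule weyl_op_bounded_clinear[OF A])
  have clR: "bounded_clinear R" and ARc: "compact_op (\<lambda>x. A (R x) - x)"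
    using R(1) by (auto simp: calkin_inverse_def)
  have "{onorm (\<lambda>x. R x + K x) | K. compact_op K} \<noteq> {}" using compact_op_zero by blast
  \<comment> \<open>The quotient norm is an infimum over compact perturbations, so some
    representative R + K of the inverse already has operator norm below 1 / e.\<close>
  then obtain K where K: "compact_op K" "onorm (\<lambda>x. R x + K x) < 1 / e"
    using cInf_lessD[OF _ R(2)[unfolded calkin_norm_def]] by blast
  have clK: "bounded_clinear K" using K(1) by (simp add: compact_op_def)
  define R' where "R' x = R x + K x" for x
  have clR': "bounded_clinear R'" unfolding R'_def by (rule bounded_clinear_add[OF clR clK])
  have bl: "bounded_linear R'" by (rule bounded_clinear_bounded_linear[OF clR'])
  have o: "onorm R' < 1 / e" "onorm R' \<ge> 0"
    using K(2) onorm_pos_le[OF bl] by (simp_all add: R'_def[abs_def])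
  define J where "J x = x + R' (B x)" for x
  have bijJ: "bij J" unfolding J_def
  proof (rule bij_id_plus_contraction[where q = "onorm R' * e"])
    show "bounded_clinear (\<lambda>x. R' (B x))" by (rule bounded_clinear_compose[OF clR' B(1)])
    show "0 \<le> onorm R' * e" using o(2) e by simp
    show "onorm R' * e < 1" using o(1) e by (simp add: field_simps)
    fix x
    have "norm (R' (B x)) \<le> onorm R' * norm (B x)" by (rule onorm[OF bl])
    also have "\<dots> \<le> onorm R' * (e * norm x)" by (rule mult_left_mono[OF B(2) o(2)])
    finally show "norm (R' (B x)) \<le> onorm R' * e * norm x" by (simp add: mult.assoc)
  qed
  have clJ: "bounded_clinear J" unfolding J_def
    by (intro bounded_clinear_add bounded_clinear_ident bounded_clinear_compose[OF clR' B(1)])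
  show ?thesis
  proof (rule weyl_opI)
    show "bounded_clinear (\<lambda>x. V (J x))" by (rule bounded_clinear_compose[OF V(1) clJ])
    show "bij (\<lambda>x. V (J x))" using bij_comp[OF bijJ V(2)] by (simp add: comp_def)
    have "approximable (\<lambda>x. A (R (B x)) - B x)"
      by (rule approximable_compose_right[OF compact_op_approximable[OF ARc] B(1)])
    moreover have "approximable (\<lambda>x. A (K (B x)))"
      by (rule approximable_compose_left[OF clA
            approximable_compose_right[OF compact_op_approximable[OF K(1)] B(1)]])
    ultimately have "approximable (\<lambda>x. (A (R (B x)) - B x) + A (K (B x)))" by (rule approximable_add)
    \<comment> \<open>Expanding gives A J = A + B + (A R B - B) + A K B, and V J = A J - L J; hence
      A + B differs from the invertible V J by exactly this operator.\<close>
    then show "approximable (\<lambda>x. L (J x) - ((A (R (B x)) - B x) + A (K (B x))))"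
      by (rule approximable_diff[OF approximable_compose_right[OF V(3) clJ]])
    fix x
    have "A (J x) = A x + A (R (B x)) + A (K (B x))"
      by (simp add: J_def R'_def bounded_clinear_add_apply[OF clA])
    then have "V (J x) + L (J x) = A x + A (R (B x)) + A (K (B x))" using V(4) by metis
    then have L: "L (J x) = A x + A (R (B x)) + A (K (B x)) - V (J x)"
      by (metis add_diff_cancel_left')
    show "A x + B x = V (J x) + (L (J x) - ((A (R (B x)) - B x) + A (K (B x))))"
      unfolding L by (simp add: algebra_simps)
  qed
qed

subsection \<open>The Weyl spectrum\<close>

lemma not_mem_weyl_spectrum_iff:
  fixes S :: "'a::{complex_inner_space, complete_space} \<Rightarrow> 'a"
  shows "l \<notin> weyl_spectrum S \<longleftrightarrow> weyl_op (op_shift S l)"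
  by (simp add: weyl_spectrum_def weyl_op_iff_fredholm_index_zero)

lemma ess_spectrum_subset_weyl_spectrum:
  fixes S :: "'a::{complex_inner_space, complete_space} \<Rightarrow> 'a"
  shows "ess_spectrum S \<subseteq> weyl_spectrum S"
proof
  fix l assume l: "l \<in> ess_spectrum S"
  show "l \<in> weyl_spectrum S"
  proof (rule ccontr)
    assume "l \<notin> weyl_spectrum S"
    then obtain R where "calkin_inverse (op_shift S l) R"
      unfolding not_mem_weyl_spectrum_iff by (rule weyl_op_calkin_inverse)
    with l show False by (auto simp: ess_spectrum_def)
  qed
qed

text \<open>For l of modulus above the norm, S - l is - l times a contraction perturbation of the
  identity, hence invertible. This confines all the Weyl spectra of a bounded sequence to one
  compact disc.\<close>

lemma weyl_spectrum_norm_le: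
  fixes S :: "'a::{complex_inner_space, complete_space} \<Rightarrow> 'a"
  assumes S: "bounded_clinear S" and l: "l \<in> weyl_spectrum S"
  shows "cmod l \<le> onorm S"
proof (rule ccontr)
  assume "\<not> ?thesis"
  then have gt: "onorm S < cmod l" by simp
  have o0: "onorm S \<ge> 0" by (rule onorm_pos_le[OF bounded_clinear_bounded_linear[OF S]])
  then have l0: "l \<noteq> 0" using gt by auto
  let ?G = "\<lambda>x. scaleC (- 1 / l) (S x)"
  have "bij (\<lambda>x. x + ?G x)"
  proof (rule bij_id_plus_contraction[where q = "onorm S / cmod l"])
    show "bounded_clinear ?G" by (rule bounded_clinear_const_scaleC[OF S])
    show "0 \<le> onorm S / cmod l" "onorm S / cmod l < 1" using o0 gt l0 by auto
    show "norm (?G x) \<le> onorm S / cmod l * norm x" for x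
      using divide_right_mono[OF onorm[OF bounded_clinear_bounded_linear[OF S], of x], of "cmod l"]
      by (simp add: norm_divide)
  qed
  moreover have "bij (\<lambda>x::'a. scaleC (- l) x)"
    by (rule o_bij[of "\<lambda>x. scaleC (- 1 / l) x"])
       (use l0 in \<open>auto simp: fun_eq_iff scaleC_scaleC scaleC_one\<close>)
  ultimately have "bij ((\<lambda>x. scaleC (- l) x) \<circ> (\<lambda>x. x + ?G x))" by (rule bij_comp)
  moreover have "(\<lambda>x. scaleC (- l) x) \<circ> (\<lambda>x. x + ?G x) = op_shift S l"
    using l0 by (simp add: fun_eq_iff op_shift_def scaleC_add_right scaleC_diff_right scaleC_scaleC scaleC_one scaleC_minus_left)
  ultimately have b: "bij (op_shift S l)" by simp
  have "approximable (\<lambda>x. 0 :: 'a)" by (rule compact_op_approximable[OF compact_op_zero])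
  then have "weyl_op (op_shift S l)" by (rule weyl_opI[OF bounded_clinear_op_shift[OF S] b]) simp
  then show False using l not_mem_weyl_spectrum_iff by blast
qed

text \<open>Let P be the projection onto the finite-dimensional complement of range T, and split
  \<open>Tn n - T\<close> into its compositions with I - P and with P. The second has finite rank.
  The first sees only vectors T u with u bounded by C times the norm of x, so it is controlled by C
  times the norm of \<open>(Tn n - T) T\<close>.\<close>

lemma nu_converges_decomposition:
  fixes T :: "'a::{complex_inner_space, complete_space} \<Rightarrow> 'a"
  assumes T: "fredholm T" and Tn: "\<And>n. bounded_clinear (Tn n)" and nu: "nu_converges Tn T"
  obtains B K b where "\<And>n. bounded_clinear (B n)" "\<And>n. approximable (K n)"
    "\<And>n x. Tn n x = T x + B n x + K n x" "\<And>n x. norm (B n x) \<le> b n * norm x" "b \<longlonglongrightarrow> 0"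
proof -
  have clT: "bounded_clinear T" and clR: "closed (range T)" and fd: "fin_dim (orth_compl (range T))"
    using T by (auto simp: fredholm_def)
  obtain E where E: "finite E" "orthonormal E" "E \<subseteq> orth_compl (range T)"
    "\<And>x. x \<in> orth_compl (range T) \<Longrightarrow> orth_proj E x = x"
    using orthonormal_basis_exists[OF csubspace_orth_compl fd] by metis
  obtain C where C: "C > 0" "\<And>y. y \<in> range T \<Longrightarrow> \<exists>x. T x = y \<and> norm x \<le> C * norm y"
    using bounded_linear_closed_range_bounded_preimage[OF bounded_clinear_bounded_linear[OF clT] clR]
    by blast
  define B where "B n x = Tn n (x - orth_proj E x) - T (x - orth_proj E x)" for n x
  define K where "K n x = Tn n (orth_proj E x) - T (orth_proj E x)" for n x
  define b where "b n = onorm (\<lambda>x. Tn n (T x) - T (T x)) * C" for n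
  have D: "bounded_clinear (\<lambda>x. Tn n x - T x)" for n by (rule bounded_clinear_diff[OF Tn clT])
  show ?thesis
  proof (rule that)
    show "bounded_clinear (B n)" for n
      using bounded_clinear_compose[OF D[of n]
          bounded_clinear_diff[OF bounded_clinear_ident bounded_clinear_orth_proj[of E]]]
      by (simp add: B_def[abs_def])
    show "approximable (K n)" for n
      using finite_rank_approximable[OF finite_rank_compose_left[OF D[of n] finite_rank_orth_proj[OF E(1)]]]
      by (simp add: K_def[abs_def])
    show "Tn n x = T x + B n x + K n x" for n x
      by (simp add: B_def K_def bounded_clinear_diff_apply[OF Tn] bounded_clinear_diff_apply[OF clT])
    show "norm (B n x) \<le> b n * norm x" for n x
    proof -
      let ?y = "x - orth_proj E x"
      have "?y \<in> range T" by (rule diff_orth_proj_mem[OF clR csubspace_range[OF clT] E(4,3)])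
      then obtain u where u: "T u = ?y" "norm u \<le> C * norm ?y" using C(2) by blast
      have "norm ?y \<le> norm x"
        using norm_diff_orth_proj_le[OF E(2,1), of 0 x]
          bounded_clinear_zero_apply[OF bounded_clinear_orth_proj[of E]] by simp
      then have nu: "norm u \<le> C * norm x" using u(2) C(1) by (smt (verit) mult_left_mono)
      have bl: "bounded_linear (\<lambda>x. Tn n (T x) - T (T x))"
        by (rule bounded_clinear_bounded_linear[OF bounded_clinear_compose[OF D clT]])
      have "norm (B n x) = norm (Tn n (T u) - T (T u))" by (simp add: B_def u(1))
      also have "\<dots> \<le> onorm (\<lambda>x. Tn n (T x) - T (T x)) * norm u" by (rule onorm[OF bl])
      also have "\<dots> \<le> onorm (\<lambda>x. Tn n (T x) - T (T x)) * (C * norm x)"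
        by (rule mult_left_mono[OF nu onorm_pos_le[OF bl]])
      finally show ?thesis by (simp add: b_def mult.assoc)
    qed
    have "(\<lambda>n. onorm (\<lambda>x. Tn n (T x) - T (T x))) \<longlonglongrightarrow> 0" using nu by (simp add: nu_converges_def)
    from tendsto_mult_left_zero[OF this, of C] show "b \<longlonglongrightarrow> 0" by (simp add: b_def[abs_def])
  qed
qed

text \<open>Lower semicontinuity. If l were further than e from the Weyl spectrum of S, the
  essential G1 condition would bound the Calkin inverse of S - l below 1 / e. As T - l = (S - l) - B
  - K, the Neumann argument absorbs - B and compact stability absorbs - K, making T - l
  Weyl.\<close>

lemma infdist_weyl_spectrum_essentially_G1_le:
  fixes S T :: "'a::{complex_inner_space, complete_space} \<Rightarrow> 'a"
  assumes S: "essentially_G1 S" "weyl_spectrum S \<noteq> {}"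
    and B: "bounded_clinear B" "\<And>x. norm (B x) \<le> e * norm x" and K: "approximable K"
    and eq: "\<And>x. S x = T x + B x + K x" and e: "e > 0"
    and l: "l \<in> weyl_spectrum T"
  shows "infdist l (weyl_spectrum S) \<le> e"
proof (rule ccontr)
  assume "\<not> ?thesis"
  then have gt: "infdist l (weyl_spectrum S) > e" by simp
  then have nl: "l \<notin> weyl_spectrum S" using e by auto
  then have w: "weyl_op (op_shift S l)" by (simp add: not_mem_weyl_spectrum_iff)
  obtain R where R: "calkin_inverse (op_shift S l) R" using w by (rule weyl_op_calkin_inverse)
  have "l \<notin> ess_spectrum S" using nl ess_spectrum_subset_weyl_spectrum by blast
  then have n: "calkin_norm R = 1 / infdist l (ess_spectrum S)"
    using S(1) R unfolding essentially_G1_def by blast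
  have "calkin_norm R < 1 / e"
  proof (cases "ess_spectrum S = {}")
    case True
    \<comment> \<open>Here \<open>infdist l {} = 0\<close>, so the junk value \<open>1 / 0 = 0\<close> appears on the right of \<open>n\<close>.\<close>
    then show ?thesis using n e by (simp add: infdist_def)
  next
    case False
    \<comment> \<open>Distance decreases when the set grows, provided the smaller set is nonempty;
      distance to the empty set is 0 by convention.\<close>
    have "infdist l (weyl_spectrum S) \<le> infdist l (ess_spectrum S)"
      by (rule infdist_mono[OF ess_spectrum_subset_weyl_spectrum False])
    then show ?thesis unfolding n using gt e by (intro divide_strict_left_mono) auto
  qed
  moreover have "bounded_clinear (\<lambda>x. scaleC (- 1) (B x))" by (rule bounded_clinear_const_scaleC[OF B(1)])
  moreover have "norm (scaleC (- 1) (B x)) \<le> e * norm x" for x using B(2) by simp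
  ultimately have "weyl_op (\<lambda>x. op_shift S l x + scaleC (- 1) (B x))"
    using weyl_op_calkin_perturbation[OF w R _ e] by blast
  moreover have "approximable (\<lambda>x. scaleC (- 1) (K x))"
    by (rule approximable_compose_left[OF bounded_clinear_const_scaleC[OF bounded_clinear_ident] K])
  ultimately have "weyl_op (\<lambda>x. op_shift S l x + scaleC (- 1) (B x) + scaleC (- 1) (K x))"
    by (rule weyl_op_add_approximable)
  moreover have "(\<lambda>x. op_shift S l x + scaleC (- 1) (B x) + scaleC (- 1) (K x)) = op_shift T l"
    by (simp add: fun_eq_iff op_shift_def eq scaleC_minus_left scaleC_one)
  ultimately show False using l not_mem_weyl_spectrum_iff by metis
qed

text \<open>Upper semicontinuity. The points of the disc at distance at least e from the Weyl
  spectrum of T form a compact set on which every T - l has a positive stability radius. A finite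
  cover makes one threshold on \<open>b n\<close> serve the whole set.\<close>

lemma eventually_infdist_weyl_spectrum_less:
  fixes T :: "'a::{complex_inner_space, complete_space} \<Rightarrow> 'a"
  assumes B: "\<And>n. bounded_clinear (B n)" and K: "\<And>n. approximable (K n)"
    and eq: "\<And>n x. Tn n x = T x + B n x + K n x" and b: "\<And>n x. norm (B n x) \<le> b n * norm x" "b \<longlonglongrightarrow> 0"
    and Tn: "\<And>n. bounded_clinear (Tn n)" "\<And>n. onorm (Tn n) \<le> M" and e: "e > 0"
  shows "eventually (\<lambda>n. \<forall>l\<in>weyl_spectrum (Tn n). infdist l (weyl_spectrum T) < e) sequentially"
proof -
  define C where "C = cball 0 M \<inter> {l. e \<le> infdist l (weyl_spectrum T)}"
  have "compact C"
    unfolding C_def by (intro compact_Int_closed compact_cball closed_Collect_le continuous_intros)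
  have "\<exists>d>0. \<forall>G. bounded_clinear G \<longrightarrow> (\<forall>x. norm (G x) \<le> d * norm x) \<longrightarrow>
      weyl_op (\<lambda>x. op_shift T l x + G x)" if l: "l \<in> C" for l
  proof -
    have "l \<notin> weyl_spectrum T" using l e by (auto simp: C_def)
    then have "weyl_op (op_shift T l)" by (simp add: not_mem_weyl_spectrum_iff)
    then obtain d where "d > 0" "\<And>G. bounded_clinear G \<Longrightarrow> (\<And>x. norm (G x) \<le> d * norm x) \<Longrightarrow>
        weyl_op (\<lambda>x. op_shift T l x + G x)" by (rule weyl_op_small_perturbation) blast
    then show ?thesis by (intro exI[of _ d]) simp
  qed
  then obtain d where d: "\<And>l. l \<in> C \<Longrightarrow> d l > 0"
    "\<And>l G. l \<in> C \<Longrightarrow> bounded_clinear G \<Longrightarrow> (\<forall>x. norm (G x) \<le> d l * norm x) \<Longrightarrow>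
      weyl_op (\<lambda>x. op_shift T l x + G x)" by metis
  have "C \<subseteq> (\<Union>l\<in>C. ball l (d l / 2))" using d(1) by force
  then obtain D where D: "D \<subseteq> C" "finite D" "C \<subseteq> (\<Union>l\<in>D. ball l (d l / 2))"
    by (rule compactE_image[OF \<open>compact C\<close> open_ball])
  have "eventually (\<lambda>n. \<forall>l\<in>D. b n < d l / 2) sequentially"
  proof (rule eventually_ball_finite[OF D(2)], intro ballI)
    fix l assume "l \<in> D"
    then have "d l / 2 > 0" using D(1) d(1) by auto
    then show "eventually (\<lambda>n. b n < d l / 2) sequentially" by (rule order_tendstoD(2)[OF b(2)])
  qed
  then show ?thesis
  proof (rule eventually_mono, intro ballI)
    fix n l assume n: "\<forall>l\<in>D. b n < d l / 2" and l: "l \<in> weyl_spectrum (Tn n)"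
    show "infdist l (weyl_spectrum T) < e"
    proof (rule ccontr)
      assume "\<not> ?thesis"
      moreover have "cmod l \<le> M" using weyl_spectrum_norm_le[OF Tn(1) l] Tn(2)[of n] by simp
      ultimately have "l \<in> C" by (simp add: C_def)
      then obtain m where m: "m \<in> D" "dist m l < d m / 2" using D(3) by auto
      \<comment> \<open>Chosen so that T_n - l = (T - m) + G + K_n. Half of the radius
        \<open>d m\<close> is spent on \<open>B n\<close> and half on the shift m - l, which is why
        the cover uses balls of radius \<open>d m / 2\<close>.\<close>
      define G where "G x = B n x + scaleC (m - l) x" for x
      have clG: "bounded_clinear G" unfolding G_def
        by (intro bounded_clinear_add B bounded_clinear_const_scaleC bounded_clinear_ident)
      have "norm (G x) \<le> d m * norm x" for x
      proof -
        have "norm (G x) \<le> norm (B n x) + norm (scaleC (m - l) x)"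
          unfolding G_def by (rule norm_triangle_ineq)
        also have "\<dots> \<le> b n * norm x + cmod (m - l) * norm x" using b(1)[of n x] by simp
        also have "\<dots> = (b n + cmod (m - l)) * norm x" by (simp add: algebra_simps)
        also have "\<dots> \<le> d m * norm x"
        proof (rule mult_right_mono)
          have "b n < d m / 2" using n m(1) by blast
          then show "b n + cmod (m - l) \<le> d m" using m(2) by (simp add: dist_norm)
        qed simp
        finally show ?thesis .
      qed
      then have "weyl_op (\<lambda>x. op_shift T m x + G x)" using d(2)[OF _ clG] m(1) D(1) by blast
      then have "weyl_op (\<lambda>x. op_shift T m x + G x + K n x)" by (rule weyl_op_add_approximable[OF _ K])
      moreover have "(\<lambda>x. op_shift T m x + G x + K n x) = op_shift (Tn n) l"
        by (simp add: fun_eq_iff op_shift_def G_def eq scaleC_diff_left)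
      ultimately show False using l not_mem_weyl_spectrum_iff by metis
    qed
  qed
qed

text \<open>The nonemptiness guards match the convention that \<open>hausdist\<close> is 0 when a
  set is empty; they allow the two one-sided estimates to be proved for nonempty spectra
  only.\<close>

lemma abs_hausdist_le:
  assumes "\<And>x. S \<noteq> {} \<Longrightarrow> T \<noteq> {} \<Longrightarrow> x \<in> S \<Longrightarrow> infdist x T \<le> e"
    and "\<And>y. S \<noteq> {} \<Longrightarrow> T \<noteq> {} \<Longrightarrow> y \<in> T \<Longrightarrow> infdist y S \<le> e" and "e \<ge> 0"
  shows "\<bar>hausdist S T\<bar> \<le> e"
proof (cases "S \<noteq> {} \<and> T \<noteq> {} \<and> bounded S \<and> bounded T")
  case True
  then obtain x where x: "x \<in> S" by blast
  have "bdd_above ((\<lambda>x. infdist x T) ` S)" 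
    by (rule bdd_aboveI2[of _ _ e]) (use assms(1) True in auto)
  then have "infdist x T \<le> (SUP x\<in>S. infdist x T)" using x by (rule cSUP_upper[rotated])
  then have "0 \<le> (SUP x\<in>S. infdist x T)" using infdist_nonneg order_trans by blast
  moreover have "(SUP x\<in>S. infdist x T) \<le> e" "(SUP y\<in>T. infdist y S) \<le> e"
    using assms(1,2) True by (auto intro!: cSUP_least)
  ultimately show ?thesis using True by (simp add: hausdist_def)
next
  case False
  then have "hausdist S T = 0" unfolding hausdist_def by (rule if_not_P)
  then show ?thesis using assms(3) by simp
qed

theorem theorem4p1:
  fixes T :: "'a::{complex_inner_space, complete_space} \<Rightarrow> 'a"
    and Tn :: "nat \<Rightarrow> 'a \<Rightarrow> 'a"
  assumes "fredholm T"
    and "0 \<notin> weyl_spectrum T \<or> 0 islimpt weyl_spectrum T"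
    and "\<And>n. essentially_G1 (Tn n)"
    and "nu_converges Tn T"
  shows "(\<lambda>n. hausdist (weyl_spectrum (Tn n)) (weyl_spectrum T)) \<longlonglongrightarrow> 0"
proof -
  have Tn: "bounded_clinear (Tn n)" for n using assms(3) by (simp add: essentially_G1_def)
  obtain M where M: "\<And>n. onorm (Tn n) \<le> M" using assms(4) by (auto simp: nu_converges_def)
  obtain B K b where B: "\<And>n. bounded_clinear (B n)" and K: "\<And>n. approximable (K n)"
    and eq: "\<And>n x. Tn n x = T x + B n x + K n x" and b: "\<And>n x. norm (B n x) \<le> b n * norm x" "b \<longlonglongrightarrow> 0"
    using nu_converges_decomposition[OF assms(1) Tn assms(4)] by blast
  show ?thesis
  proof (rule tendstoI)
    fix e :: real assume "e > 0"
    \<comment> \<open>Suprema preserve only non-strict bounds, so e / 2 leaves room for the strict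
      inequality at the end.\<close>
    then have e: "e / 2 > 0" by simp
    have "eventually (\<lambda>n. \<forall>l\<in>weyl_spectrum (Tn n). infdist l (weyl_spectrum T) < e / 2) sequentially"
      by (rule eventually_infdist_weyl_spectrum_less[OF B K eq b Tn M e])
    moreover have "eventually (\<lambda>n. b n < e / 2) sequentially" by (rule order_tendstoD(2)[OF b(2) e])
    ultimately show "eventually (\<lambda>n. dist (hausdist (weyl_spectrum (Tn n)) (weyl_spectrum T)) 0 < e) sequentially"
    proof eventually_elim
      case (elim n)
      have bn: "norm (B n x) \<le> e / 2 * norm x" for x
        by (rule order_trans[OF b(1) mult_right_mono]) (use elim(2) in auto)
      have "\<bar>hausdist (weyl_spectrum (Tn n)) (weyl_spectrum T)\<bar> \<le> e / 2"
      proof (rule abs_hausdist_le)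
        show "infdist l (weyl_spectrum T) \<le> e / 2" if "l \<in> weyl_spectrum (Tn n)" for l
          using elim(1) that by fastforce
        show "infdist l (weyl_spectrum (Tn n)) \<le> e / 2"
          if "weyl_spectrum (Tn n) \<noteq> {}" "l \<in> weyl_spectrum T" for l
          by (rule infdist_weyl_spectrum_essentially_G1_le[OF assms(3) that(1) B bn K eq e that(2)])
      qed (use e in simp)
      then show ?case using e by simp
    qed
  qed
qed

end
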